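(* For integers $1\le m\le\ell$, the equation $m(\ell-m+1)=1$ forces $m=1$ and $\ell=1$, a degree-one perturbation (a rigid translation, not a shape change). Hence no single spherical harmonic $Y_\ell^m$ of degree $\ell\ge2$ (with $1\le m\le\ell$), used as the perturbation $g=Y_\ell^m$ of the unit sphere, produces a mono-monostatic body $B_\varepsilon$.
   Context: $(\theta,\phi)$ are spherical coordinates on the unit sphere $S^2\subset\mathbb{R}^3$, with colatitude $\theta\in[0,\pi]$ and longitude $\phi$. For $1\le m\le\ell$, $Y_\ell^m(\theta,\phi)=P_\ell^m(\cos\theta)\cos(m\phi)$ is the real spherical harmonic of degree $\ell$ and order $m$, where $P_\ell^m(x)=(1-x^2)^{m/2}\,\frac{d^m}{dx^m}P_\ell(x)$ and $P_\ell$ is the Legendre polynomial of degree $\ell$. For a smooth function $g:S^2\to\mathbb{R}$ (the perturbation), $B_\varepsilon$ is the body with radial boundary $r(u)=1+\varepsilon g(u)$, $u\in S^2$, taken homogeneous (uniform mass density) and, for $\varepsilon$ small enough, convex; $\mathbf{c}$ is its centroid. The static equilibria of $B_\varepsilon$ are the critical points $u\in S^2$ of $\rho(u)=|r(u)u-\mathbf{c}|^2$; local minima of $\rho$ are stable equilibria, local maxima are unstable equilibria, and saddles are of saddle type. $S$ and $U$ are the numbers of stable and unstable equilibria. The body is mono-monostatic if $S=U=1$. The quantity $m(\ell-m+1)$ is the common value of $S$ and $U$ that the paper assigns to the body perturbed by $Y_\ell^m$.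
   Formalization: That the degree-one perturbation is "a rigid translation, not a shape change" is stated to first order in ε (the surface is within O(ε²) of a translated unit sphere), since r = 1 + εY_1^1 is not exactly a translated sphere for ε ≠ 0. *)

theory Defs
  imports "HOL-Analysis.Analysis" "HOL-Computational_Algebra.Polynomial"
begin

definition legendre_poly :: "nat \<Rightarrow> real poly" where
  "legendre_poly l = smult (1 / (2 ^ l * fact l)) ((pderiv ^^ l) ([:-1, 0, 1:] ^ l))"

text \<open>No Condon--Shortley sign.\<close>

definition assoc_legendre :: "nat \<Rightarrow> nat \<Rightarrow> real \<Rightarrow> real" where
  "assoc_legendre l m x = sqrt (1 - x\<^sup>2) ^ m * poly ((pderiv ^^ m) (legendre_poly l)) x"

definition spherical_point :: "real \<Rightarrow> real \<Rightarrow> real ^ 3" where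
  "spherical_point \<theta> \<phi> = vector [sin \<theta> * cos \<phi>, sin \<theta> * sin \<phi>, cos \<theta>]"

definition colatitude :: "real ^ 3 \<Rightarrow> real" where
  "colatitude u = arccos (u $ 3)"

text \<open>At the poles the longitude is arbitrary (here \<open>Arg 0 = 0\<close>); for \<open>m \<ge> 1\<close>
  this is immaterial, since the associated Legendre function vanishes there.\<close>

definition longitude :: "real ^ 3 \<Rightarrow> real" where
  "longitude u = Arg (Complex (u $ 1) (u $ 2))"

definition sph_harmonic :: "nat \<Rightarrow> nat \<Rightarrow> real ^ 3 \<Rightarrow> real" where
  "sph_harmonic l m u =
     assoc_legendre l m (cos (colatitude u)) * cos (real m * longitude u)"

lemma sph_harmonic_spherical_point:
  assumes "0 \<le> \<theta>" "\<theta> \<le> pi" "1 \<le> m"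
  shows "sph_harmonic l m (spherical_point \<theta> \<phi>) =
           assoc_legendre l m (cos \<theta>) * cos (real m * \<phi>)"
proof -
  let ?u = "spherical_point \<theta> \<phi>"
  have col: "colatitude ?u = \<theta>"
    using assms by (simp add: colatitude_def spherical_point_def arccos_cos)
  show ?thesis
  proof (cases "sin \<theta> = 0")
    case True
    then have "(cos \<theta>)\<^sup>2 = 1"
      using sin_cos_squared_add [of \<theta>] by simp
    then have "assoc_legendre l m (cos \<theta>) = 0"
      using assms by (simp add: assoc_legendre_def)
    then show ?thesis by (simp add: sph_harmonic_def col)
  next
    case False
    then have pos: "sin \<theta> > 0"
      using sin_ge_zero [OF assms(1,2)] by simp
    let ?z = "Complex (?u $ 1) (?u $ 2)"
    have z: "?z = complex_of_real (sin \<theta>) * cis \<phi>"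
      by (simp add: complex_eq_iff spherical_point_def)
    have "cis (longitude ?u) = sgn ?z"
      unfolding longitude_def by (rule cis_Arg) (use pos in \<open>simp add: z\<close>)
    also have "\<dots> = cis \<phi>"
      unfolding z using pos by (simp add: sgn_mult sgn_of_real sgn_cis)
    finally have "cis (longitude ?u) ^ m = cis \<phi> ^ m" by simp
    then have "cos (real m * longitude ?u) = cos (real m * \<phi>)"
      unfolding Complex.DeMoivre by (metis cis.simps(1))
    then show ?thesis by (simp add: sph_harmonic_def col)
  qed
qed

definition radial_body :: "(real ^ 3 \<Rightarrow> real) \<Rightarrow> real \<Rightarrow> (real ^ 3) set" where
  "radial_body g \<epsilon> = {t *\<^sub>R u | t u. u \<in> sphere 0 1 \<and> 0 \<le> t \<and> t \<le> 1 + \<epsilon> * g u}"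

definition centroid :: "(real ^ 3) set \<Rightarrow> real ^ 3" where
  "centroid K = integral K (\<lambda>x. x) /\<^sub>R measure lebesgue K"

definition sq_dist_fun :: "(real ^ 3 \<Rightarrow> real) \<Rightarrow> real \<Rightarrow> real ^ 3 \<Rightarrow> real" where
  "sq_dist_fun g \<epsilon> u = (norm ((1 + \<epsilon> * g u) *\<^sub>R u - centroid (radial_body g \<epsilon>)))\<^sup>2"

text \<open>A derivative taken within the sphere only sees tangential directions, so it being
  zero says that the point is critical for the restriction of the function to the sphere.\<close>

definition equilibria :: "(real ^ 3 \<Rightarrow> real) \<Rightarrow> real \<Rightarrow> (real ^ 3) set" where
  "equilibria g \<epsilon> = {u \<in> sphere 0 1.
     (sq_dist_fun g \<epsilon> has_derivative (\<lambda>_. 0)) (at u within sphere 0 1)}"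

definition stable_equilibria :: "(real ^ 3 \<Rightarrow> real) \<Rightarrow> real \<Rightarrow> (real ^ 3) set" where
  "stable_equilibria g \<epsilon> = {u \<in> equilibria g \<epsilon>.
     \<forall>\<^sub>F v in at u within sphere 0 1. sq_dist_fun g \<epsilon> u \<le> sq_dist_fun g \<epsilon> v}"

definition unstable_equilibria :: "(real ^ 3 \<Rightarrow> real) \<Rightarrow> real \<Rightarrow> (real ^ 3) set" where
  "unstable_equilibria g \<epsilon> = {u \<in> equilibria g \<epsilon>.
     \<forall>\<^sub>F v in at u within sphere 0 1. sq_dist_fun g \<epsilon> v \<le> sq_dist_fun g \<epsilon> u}"

definition mono_monostatic :: "(real ^ 3 \<Rightarrow> real) \<Rightarrow> real \<Rightarrow> bool" where
  "mono_monostatic g \<epsilon> \<longleftrightarrow>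
     card (stable_equilibria g \<epsilon>) = 1 \<and> card (unstable_equilibria g \<epsilon>) = 1"

text \<open>The surface \<open>r = 1 + \<epsilon> g\<close> is, to first order in \<open>\<epsilon>\<close> and uniformly over all
  directions, the unit sphere translated by \<open>\<epsilon> v\<close>. (The translated sphere itself has
  radial function \<open>1 + \<epsilon> (u \<bullet> v) + O(\<epsilon>\<^sup>2)\<close>, so exact equality is not to be expected.)\<close>

definition first_order_translation :: "(real ^ 3 \<Rightarrow> real) \<Rightarrow> bool" where
  "first_order_translation g \<longleftrightarrow>
     (\<exists>v C. \<exists>\<epsilon>\<^sub>0>0. \<forall>\<epsilon>. \<bar>\<epsilon>\<bar> < \<epsilon>\<^sub>0 \<longrightarrow>
        (\<forall>u\<in>sphere 0 1. \<exists>t>0. t *\<^sub>R u \<in> (+) (\<epsilon> *\<^sub>R v) ` sphere 0 1 \<and>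
           \<bar>t - (1 + \<epsilon> * g u)\<bar> \<le> C * \<epsilon>\<^sup>2))"

end

theory Submission
  imports Defs
begin

text \<open>
  The equation \<open>m * (l - m + 1) = 1\<close> forces \<open>m = l = 1\<close>, and \<open>sph_harmonic 1 1\<close> is the first
  coordinate \<open>u $ 1\<close>: to first order, perturbing by it shifts the sphere along the first axis.

  For \<open>l \<ge> 2\<close> the harmonic \<open>g\<close> is orthogonal to the three coordinate functions, which are harmonics of
  degree one. Writing the first moment of the body in spherical
  coordinates turns it into the integral of \<open>(1 + \<epsilon> * g u) ^ 4 *\<^sub>R u / 4\<close> over the sphere; its term
  linear in \<open>\<epsilon>\<close> therefore vanishes and the centroid is \<open>O(\<epsilon>\<^sup>2)\<close>
  (\<open>first_moment_radial_body\<close>, \<open>centroid_radial_body_quadratic\<close>,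
  \<open>sph_harmonic_extension_orthogonal_linear\<close>). Consequently the squared distance from the centroid is
  \<open>1 + 2 * \<epsilon> * g u + O(\<epsilon>\<^sup>2)\<close>, uniformly in \<open>u\<close> (\<open>sq_dist_fun_first_order\<close>).

  The nodal lines of \<open>g\<close> separate the sphere into regions. Suppose that two disjoint open regions are
  bounded by nodal lines and that \<open>g\<close> takes values of the same sign somewhere in each. On the boundary
  of either region the squared distance is \<open>1 + O(\<epsilon>\<^sup>2)\<close>, while somewhere inside it differs from 1 by a
  multiple of \<open>\<epsilon>\<close>, with the same sign in both. Hence each region contains a local maximum (or each
  contains a local minimum) once \<open>\<epsilon>\<close> is small, and the body has at least two unstable or at least two
  stable equilibria (\<open>not_mono_monostatic_nodal_separation\<close>).

  Such a pair of regions exists as soon as \<open>l \<ge> 2\<close>. If \<open>m \<ge> 2\<close>, take the sector of longitudes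
  \<open>\<bar>\<phi>\<bar> < pi / (2 * m)\<close> and the complement of its closure, which contains the next sector of the same sign
  (\<open>nodal_separation_sectors\<close>). If \<open>m = 1\<close>, the derivative of the Legendre polynomial has a root \<open>z\<close>
  in the open interval from -1 to 1, and the region where \<open>u $ 1 > 0\<close> and \<open>u $ 3 > z\<close> does the same
  job (\<open>nodal_separation_order_one\<close>).
\<close>

section \<open>Legendre polynomials\<close>

text \<open>Each derivative lowers the multiplicity of a factor by at most one.\<close>

lemma power_dvd_pderiv_funpow:
  fixes p :: "real poly"
  assumes "k \<le> n"
  shows "p ^ (n - k) dvd (pderiv ^^ k) (p ^ n)"
  using assms
proof (induction k)
  case 0
  then show ?case by simp
next
  case (Suc k)
  define j where "j = n - Suc k"
  have "p ^ Suc j dvd (pderiv ^^ k) (p ^ n)"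
    using Suc by (simp add: j_def Suc_diff_Suc del: power_Suc)
  then obtain q where q: "(pderiv ^^ k) (p ^ n) = p ^ Suc j * q" by (elim dvdE)
  have "(pderiv ^^ Suc k) (p ^ n) = p ^ j * (p * pderiv q + smult (of_nat (Suc j)) (pderiv p * q))"
    by (simp add: q pderiv_mult pderiv_power_Suc algebra_simps del: power_Suc)
       (simp add: algebra_simps)
  then show ?case by (simp add: j_def)
qed

text \<open>These are the boundary terms that vanish when Rodrigues' formula is integrated by parts.\<close>

lemma poly_rodrigues_boundary:
  assumes "k < l" and "\<bar>x\<bar> = 1"
  shows "poly ((pderiv ^^ k) ([:-1, 0, 1:] ^ l)) x = (0 :: real)"
proof -
  from power_dvd_pderiv_funpow [of k l "[:-1, 0, 1 :: real:]"] assms(1)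
  obtain q where "(pderiv ^^ k) ([:-1, 0, 1 :: real:] ^ l) = [:-1, 0, 1:] ^ (l - k) * q"
    by (auto elim: dvdE)
  moreover have "poly [:-1, 0, 1:] x = 0"
    using assms(2) by (auto simp: abs_if split: if_splits)
  ultimately show ?thesis using assms(1) by (simp add: power_0_left)
qed

text \<open>The antiderivative of \<open>(1 - x\<^sup>2) * P' x\<close>, where \<open>P\<close> is the Legendre polynomial, that integration by
  parts produces from Rodrigues' formula: first the weight is differentiated, then the remaining
  \<open>2 * x * P x\<close> is integrated by parts once more. It vanishes at both ends of the interval, which yields the
  orthogonality to linear functions for order one as well as an interior root of \<open>P'\<close>.\<close>

definition legendre_flux :: "nat \<Rightarrow> real poly" where
  "legendre_flux l = [:1, 0, -1:] * legendre_poly l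
     + smult (2 / (2 ^ l * fact l))
         ([:0, 1:] * (pderiv ^^ (l - 1)) ([:-1, 0, 1:] ^ l) - (pderiv ^^ (l - 2)) ([:-1, 0, 1:] ^ l))"

lemma pderiv_legendre_flux:
  assumes "2 \<le> l"
  shows "pderiv (legendre_flux l) = [:1, 0, -1:] * pderiv (legendre_poly l)"
proof -
  from assms obtain n where l: "l = Suc (Suc n)"
    by (metis add_2_eq_Suc le_Suc_ex)
  define F where "F = (pderiv ^^ n) ([:-1, 0, 1 :: real:] ^ l)"
  define c :: real where "c = 1 / (2 ^ l * fact l)"
  have P: "legendre_poly l = smult c (pderiv (pderiv F))"
    by (simp add: legendre_poly_def F_def c_def l)
  have flux: "legendre_flux l = [:1, 0, -1:] * legendre_poly l + smult (2 * c) ([:0, 1:] * pderiv F - F)"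
    by (simp add: legendre_flux_def F_def c_def l)
  show ?thesis
    unfolding flux P
    by (simp add: pderiv_add pderiv_diff pderiv_smult pderiv_mult pderiv_pCons
          smult_add_right smult_diff_right pderiv_minus numeral_poly algebra_simps)
qed

lemma poly_legendre_flux_boundary:
  assumes "2 \<le> l" and "\<bar>x\<bar> = 1"
  shows "poly (legendre_flux l) x = 0"
proof -
  have "x * x = 1" using assms(2) by (auto simp: abs_if split: if_splits)
  then show ?thesis
    using assms by (simp add: legendre_flux_def poly_rodrigues_boundary)
qed

text \<open>Rolle applied to the flux: the factor \<open>1 - z\<^sup>2\<close> has no zero strictly inside the interval.\<close>

lemma pderiv_legendre_root:
  assumes "2 \<le> l"
  obtains z where "-1 < z" "z < 1" "poly (pderiv (legendre_poly l)) z = 0"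
proof -
  have "\<exists>z>-1. z < 1 \<and> poly (pderiv (legendre_flux l)) z = 0"
  proof -
    have "\<exists>z>-1. z < 1 \<and> poly (legendre_flux l) 1 - poly (legendre_flux l) (-1)
        = (1 - (-1)) * poly (pderiv (legendre_flux l)) z"
      by (rule poly_MVT) simp
    then show ?thesis using assms by (simp add: poly_legendre_flux_boundary)
  qed
  then obtain z where z: "-1 < z" "z < 1" "poly (pderiv (legendre_flux l)) z = 0" by blast
  have "1 - z * z > 0"
    using z abs_square_less_1 [of z] by (simp add: power2_eq_square abs_if)
  with z(3) have "poly (pderiv (legendre_poly l)) z = 0"
    by (simp add: pderiv_legendre_flux [OF assms])
  with z show ?thesis using that by blast
qed

lemma degree_pderiv_funpow: "degree ((pderiv ^^ k) (p :: real poly)) = degree p - k"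
  by (induction k) (simp_all add: degree_pderiv)

lemma pderiv_funpow_neq_0:
  assumes "k \<le> degree p" "p \<noteq> 0"
  shows "(pderiv ^^ k) (p :: real poly) \<noteq> 0"
  using assms
proof (induction k)
  case (Suc k)
  then show ?case
    by (simp add: pderiv_eq_0_iff degree_pderiv_funpow)
qed simp

lemma pderiv_funpow_legendre_neq_0:
  assumes "m \<le> l"
  shows "(pderiv ^^ m) (legendre_poly l) \<noteq> 0"
proof (rule pderiv_funpow_neq_0)
  have "degree ([:-1, 0, 1 :: real:] ^ l) = 2 * l" by (simp add: degree_power_eq)
  then show "m \<le> degree (legendre_poly l)"
    using assms by (simp add: legendre_poly_def degree_pderiv_funpow)
  show "legendre_poly l \<noteq> 0"
    unfolding legendre_poly_def
    using pderiv_funpow_neq_0 [of l "[:-1, 0, 1 :: real:] ^ l"]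
    by (simp add: degree_power_eq)
qed

lemma nonzero_poly_between:
  fixes p :: "real poly"
  assumes "p \<noteq> 0" and "a < b"
  obtains x where "a < x" "x < b" "poly p x \<noteq> 0"
proof -
  have "\<not> {a<..<b} \<subseteq> {x. poly p x = 0}"
    using finite_subset poly_roots_finite [OF assms(1)] assms(2) by (metis infinite_Ioo)
  then obtain x where "x \<in> {a<..<b}" "poly p x \<noteq> 0" by blast
  then have "a < x" "x < b" "poly p x \<noteq> 0" by auto
  then show ?thesis by (rule that)
qed

section \<open>Integrals of products over boxes\<close>

text \<open>Lebesgue measure on a Euclidean space is the image of the product measure over its basis.\<close>

lemma integral_lborel_prod_Basis:
  fixes f :: "'a::euclidean_space \<Rightarrow> real \<Rightarrow> real"
  assumes "\<And>b. b \<in> Basis \<Longrightarrow> integrable lborel (f b)"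
  shows "integrable lborel (\<lambda>x. \<Prod>b\<in>Basis. f b (x \<bullet> b))"
    and "(\<integral>x. (\<Prod>b\<in>Basis. f b (x \<bullet> b)) \<partial>lborel) = (\<Prod>b\<in>Basis. \<integral>x. f b x \<partial>lborel)"
proof -
  interpret product_sigma_finite "\<lambda>_::'a. lborel :: real measure" ..
  have meas [measurable]: "f b \<in> borel_measurable borel" if "b \<in> Basis" for b
    using borel_measurable_integrable [OF assms [OF that]] by simp
  have inner: "(\<Prod>b\<in>Basis. f b ((\<Sum>c\<in>Basis. y c *\<^sub>R c) \<bullet> b)) = (\<Prod>b\<in>Basis. f b (y b))" for y
    by (intro prod.cong refl) simp
  show "integrable lborel (\<lambda>x. \<Prod>b\<in>Basis. f b (x \<bullet> b))"
    by (subst lborel_eq, subst integrable_distr_eq)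
       (simp_all add: inner product_integrable_prod assms)
  show "(\<integral>x. (\<Prod>b\<in>Basis. f b (x \<bullet> b)) \<partial>lborel) = (\<Prod>b\<in>Basis. \<integral>x. f b x \<partial>lborel)"
    by (subst lborel_eq, subst integral_distr)
       (simp_all add: inner product_integral_prod assms)
qed

lemma prod_Basis_vec: "(\<Prod>b\<in>(Basis :: (real ^ 'n) set). f b) = (\<Prod>i\<in>UNIV. f (axis i 1))"
  by (rule prod.reindex_bij_witness [of _ "\<lambda>i. axis i 1" axis_index])
     (auto simp: Basis_vec_def axis_index_axis)

text \<open>The indicator of a box is the product of the indicators of its sides, so the box can be absorbed into
  the factors.\<close>

lemma integral_cbox_vec_prod:
  fixes f :: "'n::finite \<Rightarrow> real \<Rightarrow> real" and a b :: "real ^ 'n"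
  assumes "\<And>i. continuous_on {a $ i..b $ i} (f i)"
  shows "integral (cbox a b) (\<lambda>v. \<Prod>i\<in>UNIV. f i (v $ i)) = (\<Prod>i\<in>UNIV. integral {a $ i..b $ i} (f i))"
proof -
  define F where "F c = (\<lambda>t. indicator {a $ axis_index c..b $ axis_index c} t *\<^sub>R f (axis_index c) t)"
    for c :: "real ^ 'n"
  have int: "set_integrable lborel {a $ i..b $ i} (f i)" for i
    unfolding set_integrable_def
    by (rule borel_integrable_compact) (use assms in auto)
  then have F: "integrable lborel (F c)" for c
    by (simp add: F_def set_integrable_def)
  have eq: "(\<Prod>c\<in>Basis. F c (v \<bullet> c)) = indicator (cbox a b) v *\<^sub>R (\<Prod>i\<in>UNIV. f i (v $ i))" for v
  proof (cases "v \<in> cbox a b")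
    case True
    then show ?thesis
      by (simp add: prod_Basis_vec F_def axis_index_axis inner_axis mem_box_cart)
  next
    case False
    then obtain i where "\<not> (a $ i \<le> v $ i \<and> v $ i \<le> b $ i)"
      by (auto simp: mem_box_cart)
    then have "F (axis i 1) (v $ i) = 0"
      by (auto simp: F_def axis_index_axis)
    then have "(\<Prod>i\<in>UNIV. F (axis i 1) (v $ i)) = 0"
      by (intro prod_zero) auto
    then show ?thesis
      using False by (simp add: prod_Basis_vec inner_axis)
  qed
  have "set_integrable lborel (cbox a b) (\<lambda>v. \<Prod>i\<in>UNIV. f i (v $ i))"
    using integral_lborel_prod_Basis(1) [of F] F by (simp add: eq set_integrable_def)
  then have "integral (cbox a b) (\<lambda>v. \<Prod>i\<in>UNIV. f i (v $ i))
      = (\<integral>v. (\<Prod>c\<in>Basis. F c (v \<bullet> c)) \<partial>lborel)"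
    by (simp add: set_borel_integral_eq_integral(2) [symmetric] eq set_lebesgue_integral_def)
  also have "\<dots> = (\<Prod>i\<in>UNIV. \<integral>t. F (axis i 1) t \<partial>lborel)"
    by (simp add: integral_lborel_prod_Basis(2) F) (simp add: prod_Basis_vec)
  also have "\<dots> = (\<Prod>i\<in>UNIV. integral {a $ i..b $ i} (f i))"
    using int
    by (simp add: F_def axis_index_axis set_borel_integral_eq_integral(2) [symmetric]
          set_lebesgue_integral_def)
  finally show ?thesis .
qed

section \<open>Spherical coordinates\<close>

definition polar_tangent :: "real \<Rightarrow> real \<Rightarrow> real ^ 3" where
  "polar_tangent \<theta> \<phi> = vector [cos \<theta> * cos \<phi>, cos \<theta> * sin \<phi>, - sin \<theta>]"

definition azimuthal_tangent :: "real \<Rightarrow> real \<Rightarrow> real ^ 3" where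
  "azimuthal_tangent \<theta> \<phi> = vector [- (sin \<theta> * sin \<phi>), sin \<theta> * cos \<phi>, 0]"

lemma has_derivative_spherical_point:
  "((\<lambda>v :: real ^ 3. spherical_point (v $ 2) (v $ 3)) has_derivative
     (\<lambda>h. h $ 2 *\<^sub>R polar_tangent (v $ 2) (v $ 3) + h $ 3 *\<^sub>R azimuthal_tangent (v $ 2) (v $ 3))) (at v)"
proof -
  define D where "D h = h $ 2 *\<^sub>R polar_tangent (v $ 2) (v $ 3) + h $ 3 *\<^sub>R azimuthal_tangent (v $ 2) (v $ 3)"
    for h :: "real ^ 3"
  have proj: "((\<lambda>v. v $ i) has_derivative (\<lambda>h. h $ i)) (at v)" for i :: 3
    by (intro bounded_linear_imp_has_derivative bounded_linear_vec_nth)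
  note sin = has_derivative_sin [OF proj] and cos = has_derivative_cos [OF proj]
  have "((\<lambda>v :: real ^ 3. spherical_point (v $ 2) (v $ 3) $ i) has_derivative (\<lambda>h. D h $ i)) (at v)" for i
  proof -
    consider "i = 1" | "i = 2" | "i = 3" using exhaust_3 by blast
    then show ?thesis
    proof cases
      case 1
      show ?thesis
        by (rule has_derivative_eq_rhs, unfold 1 spherical_point_def, simp, rule has_derivative_mult [OF sin cos])
           (simp add: fun_eq_iff D_def polar_tangent_def azimuthal_tangent_def algebra_simps)
    next
      case 2
      show ?thesis
        by (rule has_derivative_eq_rhs, unfold 2 spherical_point_def, simp, rule has_derivative_mult [OF sin sin])
           (simp add: fun_eq_iff D_def polar_tangent_def azimuthal_tangent_def algebra_simps)
    next
      case 3
      show ?thesis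
        by (rule has_derivative_eq_rhs, unfold 3 spherical_point_def, simp, rule cos)
           (simp add: fun_eq_iff D_def polar_tangent_def azimuthal_tangent_def algebra_simps)
    qed
  qed
  then have "((\<lambda>v :: real ^ 3. spherical_point (v $ 2) (v $ 3)) has_derivative D) (at v)"
    by (subst has_derivative_componentwise_within) (auto simp: Basis_vec_def inner_axis)
  then show ?thesis by (simp add: D_def [abs_def])
qed

lemma norm_spherical_point [simp]: "norm (spherical_point \<theta> \<phi>) = 1"
proof -
  have "(sin \<theta> * cos \<phi>)\<^sup>2 + (sin \<theta> * sin \<phi>)\<^sup>2 + (cos \<theta>)\<^sup>2 = 1"
    using sin_cos_squared_add [of \<theta>] sin_cos_squared_add [of \<phi>] by algebra
  then show ?thesis
    by (simp add: norm_vec_def L2_set_def sum_3 spherical_point_def)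
qed

text \<open>The longitude ranges over the half-open interval on which \<open>Arg\<close> takes its values.\<close>

lemma spherical_point_surj:
  assumes "norm (u :: real ^ 3) = 1"
  obtains \<theta> \<phi> where "0 \<le> \<theta>" "\<theta> \<le> pi" "-pi < \<phi>" "\<phi> \<le> pi" "u = spherical_point \<theta> \<phi>"
proof -
  have u: "(u $ 1)\<^sup>2 + (u $ 2)\<^sup>2 + (u $ 3)\<^sup>2 = 1"
    using assms by (simp add: norm_vec_def L2_set_def sum_3)
  then have "(u $ 3)\<^sup>2 \<le> 1"
    by (smt (verit) zero_le_power2)
  then have u3: "\<bar>u $ 3\<bar> \<le> 1"
    by (simp add: abs_square_le_1)
  define \<theta> where "\<theta> = arccos (u $ 3)"
  define z where "z = Complex (u $ 1) (u $ 2)"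
  have th: "0 \<le> \<theta>" "\<theta> \<le> pi" "cos \<theta> = u $ 3"
    using u3 by (simp_all add: \<theta>_def arccos_lbound arccos_ubound abs_le_iff cos_arccos)
  have "(sin \<theta>)\<^sup>2 = (cmod z)\<^sup>2"
    using u sin_cos_squared_add [of \<theta>] by (simp add: z_def cmod_power2 th(3))
  then have sin: "sin \<theta> = cmod z"
    using th(1,2) by (simp add: sin_ge_zero)
  have "z = of_real (cmod z) * cis (Arg z)"
    using rcis_cmod_Arg [of z] by (simp add: rcis_def)
  then have "u $ 1 = cmod z * cos (Arg z)" "u $ 2 = cmod z * sin (Arg z)"
    by (simp_all add: complex_eq_iff z_def)
  then have "u = spherical_point \<theta> (Arg z)"
    by (simp add: vec_eq_iff forall_3 spherical_point_def sin th(3))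
  then show ?thesis using that [of \<theta> "Arg z"] th Arg_bounded [of z] by blast
qed

text \<open>The map is the derivative of \<open>(s, \<theta>, \<phi>) \<mapsto> s * r(\<theta>, \<phi>)\<close> times the unit vector with angles
  \<open>\<theta>\<close> and \<open>\<phi>\<close>, where \<open>a\<close> and \<open>b\<close> are the partial derivatives of \<open>r\<close>. They contribute only radial
  multiples to the last two columns, and the first column is radial too, so they drop out of the
  determinant.\<close>

lemma det_spherical_chart:
  "\<bar>det (matrix (\<lambda>h :: real ^ 3. (h $ 1 * r + s * (h $ 2 * a + h $ 3 * b)) *\<^sub>R spherical_point \<theta> \<phi>
      + (s * r) *\<^sub>R (h $ 2 *\<^sub>R polar_tangent \<theta> \<phi> + h $ 3 *\<^sub>R azimuthal_tangent \<theta> \<phi>)))\<bar>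
    = s\<^sup>2 * \<bar>r\<bar> ^ 3 * \<bar>sin \<theta>\<bar>"
proof -
  have "det (matrix (\<lambda>h :: real ^ 3. (h $ 1 * r + s * (h $ 2 * a + h $ 3 * b)) *\<^sub>R spherical_point \<theta> \<phi>
      + (s * r) *\<^sub>R (h $ 2 *\<^sub>R polar_tangent \<theta> \<phi> + h $ 3 *\<^sub>R azimuthal_tangent \<theta> \<phi>)))
    = s\<^sup>2 * r ^ 3 * sin \<theta> * (((sin \<theta>)\<^sup>2 + (cos \<theta>)\<^sup>2) * ((sin \<phi>)\<^sup>2 + (cos \<phi>)\<^sup>2))"
    unfolding det_3 matrix_def
    by (simp add: spherical_point_def polar_tangent_def azimuthal_tangent_def axis_def
          del: sin_cos_squared_add sin_cos_squared_add2)
       (simp add: algebra_simps power2_eq_square power3_eq_cube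
          del: sin_cos_squared_add sin_cos_squared_add2 sin_cos_squared_add3)
  also have "\<dots> = s\<^sup>2 * r ^ 3 * sin \<theta>" by simp
  finally show ?thesis by (simp add: abs_mult power_abs)
qed

lemma colatitude_spherical_point:
  "0 \<le> \<theta> \<Longrightarrow> \<theta> \<le> pi \<Longrightarrow> colatitude (spherical_point \<theta> \<phi>) = \<theta>"
  by (simp add: colatitude_def spherical_point_def arccos_cos)

lemma longitude_spherical_point:
  assumes "0 < \<theta>" "\<theta> < pi" "-pi < \<phi>" "\<phi> \<le> pi"
  shows "longitude (spherical_point \<theta> \<phi>) = \<phi>"
  unfolding longitude_def
proof (rule Arg_unique')
  show "sin \<theta> > 0" using assms sin_gt_zero by blast
  show "Complex (spherical_point \<theta> \<phi> $ 1) (spherical_point \<theta> \<phi> $ 2) = rcis (sin \<theta>) \<phi>"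
    by (simp add: spherical_point_def complex_eq_iff)
qed (use assms in simp)

text \<open>The closure of the parameter domain, with the coordinates in the order relative radius (the distance
  divided by that of the boundary in the same direction), colatitude, longitude.\<close>

definition chart_box :: "(real ^ 3) set" where
  "chart_box = cbox (vector [0, 0, -pi]) (vector [1, pi, pi])"

lemma integral_chart_box_prod:
  assumes "continuous_on {0..1} a" "continuous_on {0..pi} b" "continuous_on {-pi..pi} c"
  shows "integral chart_box (\<lambda>v. a (v $ 1) * b (v $ 2) * c (v $ 3))
    = integral {0..1} a * integral {0..pi} b * (integral {-pi..pi} c :: real)"
proof -
  define f :: "3 \<Rightarrow> real \<Rightarrow> real" where "f i = (if i = 1 then a else if i = 2 then b else c)" for i
  have "\<forall>i. continuous_on {vector [0, 0, -pi] $ i..vector [1, pi, pi] $ i :: real} (f i)"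
    using assms by (simp add: forall_3 f_def)
  then have "integral chart_box (\<lambda>v. \<Prod>i\<in>UNIV. f i (v $ i))
      = (\<Prod>i\<in>UNIV. integral {vector [0, 0, -pi] $ i..vector [1, pi, pi] $ i :: real} (f i))"
    unfolding chart_box_def by (intro integral_cbox_vec_prod) blast
  moreover have "(\<Prod>i\<in>UNIV. h i) = h 1 * h 2 * h 3" for h :: "3 \<Rightarrow> real"
    unfolding UNIV_3 by (simp add: mult.assoc)
  ultimately show ?thesis by (simp add: f_def)
qed

lemma continuous_on_spherical_point [continuous_intros]:
  "continuous_on S (\<lambda>v :: real ^ 3. spherical_point (v $ 2) (v $ 3))"
proof (rule differentiable_imp_continuous_on)
  show "(\<lambda>v :: real ^ 3. spherical_point (v $ 2) (v $ 3)) differentiable_on S"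
    unfolding differentiable_on_def
    by (intro ballI differentiableI) (rule has_derivative_at_withinI [OF has_derivative_spherical_point])
qed

section \<open>First moment and volume of a radial body\<close>

text \<open>Change of variables to coordinates that straighten the body: the relative radius \<open>v $ 1\<close> runs from 0 to
  1 in every direction. The Jacobian contributes three powers of \<open>1 + \<epsilon> * G\<close> and two of \<open>v $ 1\<close>, the
  point that is integrated one more of each. The differentiable extension \<open>G\<close> of \<open>g\<close> gives access to
  derivatives in the ambient space.\<close>

lemma first_moment_radial_body:
  fixes G :: "real ^ 3 \<Rightarrow> real"
  assumes diff: "\<And>y. G differentiable (at y)"
    and g: "\<And>u. norm u = 1 \<Longrightarrow> g u = G u"
    and pos: "\<And>u. norm u = 1 \<Longrightarrow> 0 < 1 + \<epsilon> * g u"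
  shows "integral (radial_body g \<epsilon>) (\<lambda>x. x) = integral chart_box
    (\<lambda>v. ((v $ 1) ^ 3 * (1 + \<epsilon> * G (spherical_point (v $ 2) (v $ 3))) ^ 4 * sin (v $ 2))
          *\<^sub>R spherical_point (v $ 2) (v $ 3))"
proof -
  define sp where "sp v = spherical_point (v $ 2) (v $ 3)" for v :: "real ^ 3"
  define R where "R v = 1 + \<epsilon> * G (sp v)" for v
  define \<Gamma> where "\<Gamma> v = (v $ 1 * R v) *\<^sub>R sp v" for v
  \<comment> \<open>The surface \<open>v $ 1 = 1\<close> is kept, so that the image misses only directions with \<open>y $ 2 = 0\<close>, a null set.\<close>
  define \<Omega> where "\<Omega> = {v :: real ^ 3. 0 < v $ 1 \<and> v $ 1 \<le> 1 \<and> 0 < v $ 2 \<and> v $ 2 < pi \<and> -pi < v $ 3 \<and> v $ 3 < pi}"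
  define H where "H v = ((v $ 1) ^ 3 * R v ^ 4 * sin (v $ 2)) *\<^sub>R sp v" for v
  have norm_sp [simp]: "norm (sp v) = 1" for v by (simp add: sp_def)
  have R_pos: "0 < R v" for v using pos [of "sp v"] g [of "sp v"] by (simp add: R_def)

  have box: "box (vector [0, 0, -pi]) (vector [1, pi, pi]) \<subseteq> \<Omega>" and cbox: "\<Omega> \<subseteq> chart_box"
    by (auto simp: \<Omega>_def chart_box_def mem_box_cart forall_3)
  have neg: "negligible (chart_box - \<Omega>)"
    by (rule negligible_subset [OF negligible_frontier_interval]) (use box in \<open>auto simp: chart_box_def\<close>)
  have "\<Omega> = chart_box - (chart_box - \<Omega>)" using cbox by blast
  then have \<Omega>: "\<Omega> \<in> sets lebesgue"
    using negligible_imp_sets [OF neg] by (metis chart_box_def lmeasurable_cbox fmeasurableD sets.Diff)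

  define A where "A v = \<epsilon> * frechet_derivative G (at (sp v)) (polar_tangent (v $ 2) (v $ 3))" for v
  define B where "B v = \<epsilon> * frechet_derivative G (at (sp v)) (azimuthal_tangent (v $ 2) (v $ 3))" for v
  define \<Gamma>' where "\<Gamma>' v h = (h $ 1 * R v + v $ 1 * (h $ 2 * A v + h $ 3 * B v)) *\<^sub>R sp v
      + (v $ 1 * R v) *\<^sub>R (h $ 2 *\<^sub>R polar_tangent (v $ 2) (v $ 3) + h $ 3 *\<^sub>R azimuthal_tangent (v $ 2) (v $ 3))"
    for v h :: "real ^ 3"
  have d\<Gamma>: "(\<Gamma> has_derivative \<Gamma>' v) (at v)" for v
  proof -
    let ?D = "\<lambda>h. h $ 2 *\<^sub>R polar_tangent (v $ 2) (v $ 3) + h $ 3 *\<^sub>R azimuthal_tangent (v $ 2) (v $ 3)"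
    let ?G' = "frechet_derivative G (at (sp v))"
    have dsp: "(sp has_derivative ?D) (at v)"
      unfolding sp_def by (rule has_derivative_spherical_point)
    have dG: "(G has_derivative ?G') (at (sp v))"
      using diff frechet_derivative_works by blast
    have lin: "?G' (?D h) = h $ 2 * ?G' (polar_tangent (v $ 2) (v $ 3)) + h $ 3 * ?G' (azimuthal_tangent (v $ 2) (v $ 3))" for h
      using has_derivative_linear [OF dG] by (simp add: linear_add linear_scale)
    have "((\<lambda>v. G (sp v)) has_derivative (\<lambda>h. ?G' (?D h))) (at v)"
      by (rule has_derivative_compose [OF dsp dG])
    then have dR: "(R has_derivative (\<lambda>h. h $ 2 * A v + h $ 3 * B v)) (at v)"
      unfolding R_def [abs_def] lin
      by (auto intro!: derivative_eq_intros simp: A_def B_def algebra_simps)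
    have "((\<lambda>v. v $ 1) has_derivative (\<lambda>h. h $ 1)) (at v)"
      by (intro bounded_linear_imp_has_derivative bounded_linear_vec_nth)
    from has_derivative_scaleR [OF has_derivative_mult [OF this dR] dsp]
    show ?thesis
      unfolding \<Gamma>_def [abs_def]
      by (rule has_derivative_eq_rhs) (simp add: \<Gamma>'_def fun_eq_iff algebra_simps)
  qed

  \<comment> \<open>The norm and the direction of the image recover the parameters.\<close>
  have inj: "inj_on \<Gamma> \<Omega>"
  proof (rule inj_onI)
    fix v w assume v: "v \<in> \<Omega>" and w: "w \<in> \<Omega>" and eq: "\<Gamma> v = \<Gamma> w"
    have nv: "norm (\<Gamma> v) = v $ 1 * R v" and nw: "norm (\<Gamma> w) = w $ 1 * R w"
      using v w R_pos [of v] R_pos [of w] by (simp_all add: \<Gamma>_def \<Omega>_def abs_mult)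
    have sR: "v $ 1 * R v = w $ 1 * R w" using nv nw eq by simp
    moreover have "v $ 1 * R v > 0" using v R_pos [of v] by (simp add: \<Omega>_def)
    ultimately have sp: "sp v = sp w" using eq by (auto simp: \<Gamma>_def)
    then have "v $ 1 = w $ 1" using sR R_pos [of w] by (simp add: R_def)
    moreover have "v $ 2 = w $ 2"
      using v w arg_cong [OF sp, of colatitude] by (simp add: sp_def \<Omega>_def colatitude_spherical_point)
    moreover have "v $ 3 = w $ 3"
      using v w arg_cong [OF sp, of longitude] by (simp add: sp_def \<Omega>_def longitude_spherical_point)
    ultimately show "v = w" by (simp add: vec_eq_iff forall_3)
  qed

  have H: "\<bar>det (matrix (\<Gamma>' v))\<bar> *\<^sub>R \<Gamma> v = H v" if "v \<in> \<Omega>" for v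
  proof -
    have "\<bar>det (matrix (\<Gamma>' v))\<bar> = (v $ 1)\<^sup>2 * R v ^ 3 * sin (v $ 2)"
      unfolding \<Gamma>'_def [abs_def] sp_def det_spherical_chart
      using R_pos [of v] that by (simp add: \<Omega>_def sin_ge_zero)
    then show ?thesis
      by (simp add: \<Gamma>_def H_def power2_eq_square power3_eq_cube power4_eq_xxxx mult_ac)
  qed
  have contG: "continuous_on S G" for S
    by (intro differentiable_imp_continuous_on differentiable_at_imp_differentiable_on diff)
  have "continuous_on chart_box H"
    unfolding H_def [abs_def] R_def sp_def
    by (intro continuous_intros continuous_on_compose2 [OF contG [of UNIV]]) auto
  then have "H absolutely_integrable_on chart_box"
    unfolding chart_box_def by (rule absolutely_integrable_continuous)
  then have "H absolutely_integrable_on \<Omega>"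
    by (rule set_integrable_subset) (use \<Omega> cbox in auto)
  then have "(\<lambda>v. \<bar>det (matrix (\<Gamma>' v))\<bar> *\<^sub>R \<Gamma> v) absolutely_integrable_on \<Omega>"
    by (subst set_integrable_cong [OF refl refl H])
  moreover have "integral \<Omega> (\<lambda>v. \<bar>det (matrix (\<Gamma>' v))\<bar> *\<^sub>R \<Gamma> v) = integral \<Omega> H"
    by (rule integral_cong) (rule H)
  ultimately have "integral (\<Gamma> ` \<Omega>) (\<lambda>x. x) = integral \<Omega> H"
    using has_absolute_integral_change_of_variables
            [OF \<Omega> has_derivative_at_withinI [OF d\<Gamma>] inj, of "\<lambda>x. x" "integral \<Omega> H"]
    by simp
  moreover have "integral \<Omega> H = integral chart_box H"
    using cbox neg by (rule integral_subset_negligible)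
  moreover have "integral (\<Gamma> ` \<Omega>) (\<lambda>x. x) = integral (radial_body g \<epsilon>) (\<lambda>x. x)"
  proof (rule integral_subset_negligible)
    show "\<Gamma> ` \<Omega> \<subseteq> radial_body g \<epsilon>"
    proof
      fix y assume "y \<in> \<Gamma> ` \<Omega>"
      then obtain v where v: "v \<in> \<Omega>" "y = \<Gamma> v" by blast
      have "0 \<le> v $ 1 * R v" "v $ 1 * R v \<le> 1 * R v"
        using v R_pos [of v] by (auto simp: \<Omega>_def intro!: mult_right_mono)
      then show "y \<in> radial_body g \<epsilon>"
        unfolding radial_body_def
        by (auto intro!: exI [of _ "v $ 1 * R v"] exI [of _ "sp v"] simp: v \<Gamma>_def R_def g)
    qed
    \<comment> \<open>Only the origin, the polar axis and the half-plane of longitude \<open>pi\<close> are missed.\<close>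
    have "radial_body g \<epsilon> - \<Gamma> ` \<Omega> \<subseteq> {y. y $ 2 = 0}"
    proof
      fix y assume y: "y \<in> radial_body g \<epsilon> - \<Gamma> ` \<Omega>"
      then obtain t u where tu: "y = t *\<^sub>R u" "norm u = 1" "0 \<le> t" "t \<le> 1 + \<epsilon> * g u"
        by (auto simp: radial_body_def)
      obtain \<theta> \<phi> where a: "0 \<le> \<theta>" "\<theta> \<le> pi" "-pi < \<phi>" "\<phi> \<le> pi" "u = spherical_point \<theta> \<phi>"
        using spherical_point_surj [OF tu(2)] .
      show "y \<in> {y. y $ 2 = 0}"
      proof (rule ccontr)
        assume "y \<notin> {y. y $ 2 = 0}"
        then have nz: "t \<noteq> 0" "sin \<theta> \<noteq> 0" "sin \<phi> \<noteq> 0" by (auto simp: tu(1) a(5) spherical_point_def)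
        then have lt: "0 < \<theta>" "\<theta> < pi" "\<phi> < pi" "0 < t" using a tu(3) by (auto simp: less_le)
        define v :: "real ^ 3" where "v = vector [t / (1 + \<epsilon> * g u), \<theta>, \<phi>]"
        have v: "sp v = u" "v $ 1 = t / (1 + \<epsilon> * g u)" "v $ 2 = \<theta>" "v $ 3 = \<phi>"
          by (simp_all add: v_def sp_def a(5))
        have "v \<in> \<Omega>" using lt a tu pos [of u] by (simp add: \<Omega>_def v)
        moreover have "\<Gamma> v = y" using pos [of u] tu by (simp add: \<Gamma>_def R_def v g)
        ultimately show False using y by blast
      qed
    qed
    then show "negligible (radial_body g \<epsilon> - \<Gamma> ` \<Omega>)"
      by (rule negligible_subset [OF negligible_standard_hyperplane_cart])
  qed
  ultimately show ?thesis by (simp add: H_def [abs_def] R_def sp_def)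
qed

text \<open>The body is a continuous image of the product of the sphere with the unit interval.\<close>

lemma compact_radial_body:
  assumes "continuous_on (sphere 0 1) g" and "\<And>u. norm u = 1 \<Longrightarrow> 0 < 1 + \<epsilon> * g u"
  shows "compact (radial_body g \<epsilon>)"
proof -
  have "radial_body g \<epsilon> = (\<lambda>(u, s). (s * (1 + \<epsilon> * g u)) *\<^sub>R u) ` (sphere 0 1 \<times> {0..1})" (is "_ = ?f ` _")
  proof (intro equalityI subsetI)
    fix y assume "y \<in> radial_body g \<epsilon>"
    then obtain t u where tu: "y = t *\<^sub>R u" "norm u = 1" "0 \<le> t" "t \<le> 1 + \<epsilon> * g u"
      by (auto simp: radial_body_def)
    show "y \<in> ?f ` (sphere 0 1 \<times> {0..1})"
    proof (rule image_eqI)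
      show "y = ?f (u, t / (1 + \<epsilon> * g u))" using assms(2) [of u] tu by simp
      show "(u, t / (1 + \<epsilon> * g u)) \<in> sphere 0 1 \<times> {0..1}" using assms(2) [of u] tu by simp
    qed
  next
    fix y assume "y \<in> ?f ` (sphere 0 1 \<times> {0..1})"
    then obtain s u where su: "norm u = 1" "0 \<le> s" "s \<le> 1" "y = (s * (1 + \<epsilon> * g u)) *\<^sub>R u" by auto
    then have "0 \<le> s * (1 + \<epsilon> * g u)" "s * (1 + \<epsilon> * g u) \<le> 1 + \<epsilon> * g u"
      using assms(2) [of u] by (auto simp: mult_le_cancel_right1)
    with su show "y \<in> radial_body g \<epsilon>" by (auto simp: radial_body_def)
  qed
  moreover have "continuous_on (sphere 0 1 \<times> {0..1}) ?f"
    unfolding case_prod_unfold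
    by (intro continuous_intros continuous_on_compose2 [OF assms(1)]) auto
  ultimately show ?thesis by (simp add: compact_continuous_image compact_Times)
qed

lemma measure_radial_body_ge:
  assumes "continuous_on (sphere 0 1) g" and "\<And>u. norm u = 1 \<Longrightarrow> a \<le> 1 + \<epsilon> * g u" and "0 < a"
  shows "measure lebesgue (ball (0 :: real ^ 3) a) \<le> measure lebesgue (radial_body g \<epsilon>)"
proof (rule measure_mono_fmeasurable)
  show "ball 0 a \<subseteq> radial_body g \<epsilon>"
  proof
    fix y :: "real ^ 3" assume y: "y \<in> ball 0 a"
    obtain u :: "real ^ 3" where u: "norm u = 1" "y = norm y *\<^sub>R u"
    proof (cases "y = 0")
      case True
      then show ?thesis using that [of "axis 1 1"] by simp
    next
      case False
      then show ?thesis using that [of "y /\<^sub>R norm y"] by simp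
    qed
    have "norm y \<le> 1 + \<epsilon> * g u"
      using assms(2) [OF u(1)] y by simp
    then show "y \<in> radial_body g \<epsilon>"
      unfolding radial_body_def
      by (intro CollectI exI [of _ "norm y"] exI [of _ u] conjI u(2)) (simp_all add: u(1))
  qed
  have "0 < 1 + \<epsilon> * g u" if "norm u = 1" for u
    using assms(2) [OF that] assms(3) by linarith
  then show "radial_body g \<epsilon> \<in> lmeasurable"
    using assms(1) by (intro lmeasurable_compact compact_radial_body)
qed simp

lemma integral_chart_box_vector_eq_0:
  fixes F :: "real ^ 3 \<Rightarrow> real ^ 3"
  assumes "continuous_on chart_box F"
    and "\<And>i. integral chart_box (\<lambda>v. F v $ i) = 0"
  shows "integral chart_box F = 0"
proof -
  have "F integrable_on chart_box"
    using assms(1) unfolding chart_box_def by (rule integrable_continuous)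
  then show ?thesis
    using assms(2) by (simp add: vec_eq_iff)
qed

section \<open>The centroid is of second order\<close>

lemma integral_sin_cos_0_pi: "integral {0..pi} (\<lambda>\<theta>. sin \<theta> * cos \<theta>) = 0"
proof -
  have "((\<lambda>\<theta>. sin \<theta> * cos \<theta>) has_integral ((sin pi)\<^sup>2 / 2 - (sin 0)\<^sup>2 / 2)) {0..pi}"
    by (rule fundamental_theorem_of_calculus)
       (auto simp: has_real_derivative_iff_has_vector_derivative [symmetric] intro!: derivative_eq_intros)
  then show ?thesis by (simp add: integral_unique)
qed

lemma integral_cos_multiple:
  assumes "1 \<le> n"
  shows "((\<lambda>\<phi>. cos (real n * \<phi>)) has_integral 0) {-pi..pi}"
proof -
  have "((\<lambda>\<phi>. cos (real n * \<phi>)) has_integral (sin (real n * pi) / n - sin (real n * (-pi)) / n)) {-pi..pi}"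
    by (rule fundamental_theorem_of_calculus)
       (use assms in \<open>auto simp: has_real_derivative_iff_has_vector_derivative [symmetric] intro!: derivative_eq_intros\<close>)
  then show ?thesis by (simp add: sin_npi)
qed

lemma integral_sin_multiple:
  "((\<lambda>\<phi>. sin (real n * \<phi>)) has_integral 0) {-pi..pi}"
proof (cases "n = 0")
  case False
  have "((\<lambda>\<phi>. sin (real n * \<phi>)) has_integral (- cos (real n * pi) / n - (- cos (real n * (-pi)) / n))) {-pi..pi}"
    by (rule fundamental_theorem_of_calculus)
       (use False in \<open>auto simp: has_real_derivative_iff_has_vector_derivative [symmetric] intro!: derivative_eq_intros\<close>)
  then show ?thesis by simp
qed simp

text \<open>The first moment of the unperturbed ball.\<close>

lemma integral_chart_volume_times_point:
  "integral chart_box (\<lambda>v. ((v $ 1) ^ 3 * sin (v $ 2)) *\<^sub>R spherical_point (v $ 2) (v $ 3)) = 0"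
proof (rule integral_chart_box_vector_eq_0)
  show "continuous_on chart_box (\<lambda>v. ((v $ 1) ^ 3 * sin (v $ 2)) *\<^sub>R spherical_point (v $ 2) (v $ 3))"
    by (intro continuous_intros)
next
  have "integral chart_box (\<lambda>v. (v $ 1) ^ 3 * (sin (v $ 2) * sin (v $ 2)) * cos (v $ 3)) = 0"
    using integral_cos_multiple [of 1]
    by (subst integral_chart_box_prod) (auto intro!: continuous_intros simp: integral_unique)
  moreover have "integral chart_box (\<lambda>v. (v $ 1) ^ 3 * (sin (v $ 2) * sin (v $ 2)) * sin (v $ 3)) = 0"
    using integral_sin_multiple [of 1]
    by (subst integral_chart_box_prod) (auto intro!: continuous_intros simp: integral_unique)
  moreover have "integral chart_box (\<lambda>v. (v $ 1) ^ 3 * (sin (v $ 2) * cos (v $ 2)) * 1) = 0"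
    by (subst integral_chart_box_prod)
       (auto intro!: continuous_intros simp: integral_sin_cos_0_pi)
  ultimately have "\<forall>i. integral chart_box (\<lambda>v. (((v $ 1) ^ 3 * sin (v $ 2)) *\<^sub>R spherical_point (v $ 2) (v $ 3)) $ i) = 0"
    by (simp add: forall_3 spherical_point_def mult.assoc)
  then show "integral chart_box (\<lambda>v. (((v $ 1) ^ 3 * sin (v $ 2)) *\<^sub>R spherical_point (v $ 2) (v $ 3)) $ i) = 0" for i
    by blast
qed

text \<open>In the first moment the term of order zero vanishes by symmetry and the linear one by the
  orthogonality assumption. The remaining terms of \<open>(1 + \<epsilon> * G) ^ 4\<close> are quadratic, and the volume is
  bounded below because the body contains a fixed ball.\<close>

lemma centroid_radial_body_quadratic:
  fixes G :: "real ^ 3 \<Rightarrow> real"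
  assumes diff: "\<And>y. G differentiable (at y)"
    and g: "\<And>u. norm u = 1 \<Longrightarrow> g u = G u"
    and orth: "integral chart_box (\<lambda>v. ((v $ 1) ^ 3 * sin (v $ 2) * G (spherical_point (v $ 2) (v $ 3)))
                 *\<^sub>R spherical_point (v $ 2) (v $ 3)) = 0"
  obtains C \<delta> where "0 < \<delta>" "\<And>\<epsilon>. \<bar>\<epsilon>\<bar> < \<delta> \<Longrightarrow> norm (centroid (radial_body g \<epsilon>)) \<le> C * \<epsilon>\<^sup>2"
proof -
  define sp where "sp v = spherical_point (v $ 2) (v $ 3)" for v :: "real ^ 3"
  have norm_sp [simp]: "norm (sp v) = 1" for v by (simp add: sp_def)
  have contG: "continuous_on S G" for S
    by (intro differentiable_imp_continuous_on differentiable_at_imp_differentiable_on diff)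
  have cont_sp: "continuous_on S sp" for S
    unfolding sp_def [abs_def] by (rule continuous_on_spherical_point)
  have cont: "continuous_on S (\<lambda>v. G (sp v))" for S
    by (rule continuous_on_compose2 [OF contG [of UNIV] cont_sp]) auto
  have "bounded (G ` sphere 0 1)"
    by (intro compact_imp_bounded compact_continuous_image contG) simp
  then obtain K0 where "\<forall>u\<in>sphere 0 1. \<bar>G u\<bar> \<le> K0"
    by (auto simp: bounded_iff)
  then have K0: "\<And>u. norm u = 1 \<Longrightarrow> \<bar>G u\<bar> \<le> K0" by simp
  define K where "K = max 1 K0"
  have K: "1 \<le> K" "\<And>u. norm u = 1 \<Longrightarrow> \<bar>G u\<bar> \<le> K"
    using K0 by (auto simp: K_def le_max_iff_disj)
  define \<mu> where "\<mu> = measure lebesgue (ball (0 :: real ^ 3) (1/2))"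
  have \<mu>: "0 < \<mu>" unfolding \<mu>_def using content_ball_pos [of "1/2" "0 :: real ^ 3"] by simp
  \<comment> \<open>The sum of the binomial coefficients 6, 4 and 1 of the terms beyond the linear one.\<close>
  define M where "M = 11 * K ^ 4 * measure lborel chart_box"
  define F0 where "F0 v = ((v $ 1) ^ 3 * sin (v $ 2)) *\<^sub>R sp v" for v
  define F1 where "F1 v = ((v $ 1) ^ 3 * sin (v $ 2) * G (sp v)) *\<^sub>R sp v" for v
  have int0: "(F0 has_integral 0) chart_box" and int1: "(F1 has_integral 0) chart_box"
  proof -
    have "F0 integrable_on chart_box" "F1 integrable_on chart_box"
      unfolding chart_box_def F0_def [abs_def] F1_def [abs_def]
      by (intro integrable_continuous continuous_intros cont_sp cont)+
    moreover have "integral chart_box F0 = 0" "integral chart_box F1 = 0"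
      using integral_chart_volume_times_point orth
      by (simp_all add: F0_def [abs_def] F1_def [abs_def] sp_def [abs_def])
    ultimately show "(F0 has_integral 0) chart_box" "(F1 has_integral 0) chart_box"
      by (metis integrable_integral)+
  qed

  \<comment> \<open>For such \<open>\<epsilon>\<close> the radial function is at least \<open>1 / 2\<close>.\<close>
  have bound: "norm (centroid (radial_body g \<epsilon>)) \<le> M / \<mu> * \<epsilon>\<^sup>2" if \<epsilon>: "\<bar>\<epsilon>\<bar> < 1 / (2 * K)" for \<epsilon>
  proof -
    have "1 / (2 * K) \<le> 1" using K(1) by simp
    then have \<epsilon>1: "\<bar>\<epsilon>\<bar> \<le> 1" using \<epsilon> by linarith
    have \<epsilon>K: "\<bar>\<epsilon>\<bar> * K \<le> 1/2"
      using \<epsilon> K(1) by (simp add: field_simps)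
    have half: "1/2 \<le> 1 + \<epsilon> * g u" if "norm u = 1" for u
    proof -
      have "\<bar>\<epsilon> * g u\<bar> \<le> \<bar>\<epsilon>\<bar> * K"
        unfolding abs_mult using K(2) [OF that] g [OF that] by (intro mult_left_mono) auto
      then show ?thesis using \<epsilon>K by linarith
    qed
    define F where "F v = ((v $ 1) ^ 3 * (1 + \<epsilon> * G (sp v)) ^ 4 * sin (v $ 2)) *\<^sub>R sp v" for v
    have moment: "integral (radial_body g \<epsilon>) (\<lambda>x. x) = integral chart_box F"
      unfolding F_def [abs_def] sp_def
      by (rule first_moment_radial_body [OF diff g]) (use half in \<open>auto intro: less_le_trans [of 0 "1/2"]\<close>)
    have "F integrable_on chart_box"
      unfolding chart_box_def F_def [abs_def]
      by (intro integrable_continuous continuous_intros cont_sp cont)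
    then have "(F has_integral integral chart_box F) chart_box"
      by (rule integrable_integral)
    from has_integral_diff [OF has_integral_diff [OF this int0] has_integral_cmul [OF int1, of "4 * \<epsilon>"]]
    have int: "((\<lambda>v. F v - F0 v - (4 * \<epsilon>) *\<^sub>R F1 v) has_integral integral chart_box F) chart_box"
      by simp
    have rem: "norm (F v - F0 v - (4 * \<epsilon>) *\<^sub>R F1 v) \<le> 11 * K ^ 4 * \<epsilon>\<^sup>2" if "v \<in> chart_box" for v
    proof -
      define x where "x = G (sp v)"
      have x: "\<bar>x\<bar> \<le> K" using K(2) by (simp add: x_def)
      have s: "\<bar>(v $ 1) ^ 3 * sin (v $ 2)\<bar> \<le> 1"
      proof -
        have "\<bar>v $ 1\<bar> ^ 3 \<le> 1"
          using that by (intro power_le_one) (auto simp: chart_box_def mem_box_cart forall_3)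
        then show ?thesis
          by (simp add: abs_mult power_abs mult_le_one)
      qed
      have "F v - F0 v - (4 * \<epsilon>) *\<^sub>R F1 v
          = ((v $ 1) ^ 3 * sin (v $ 2) * (\<epsilon>\<^sup>2 * (6 * x\<^sup>2 + 4 * \<epsilon> * x ^ 3 + \<epsilon>\<^sup>2 * x ^ 4))) *\<^sub>R sp v"
        unfolding F_def F0_def F1_def x_def [symmetric] scaleR_diff_left [symmetric] scaleR_scaleR
        by (intro arg_cong2 [of _ _ _ _ "(*\<^sub>R)"] refl)
           (simp add: power2_eq_square power3_eq_cube power4_eq_xxxx algebra_simps)
      then have "norm (F v - F0 v - (4 * \<epsilon>) *\<^sub>R F1 v)
          = \<bar>(v $ 1) ^ 3 * sin (v $ 2)\<bar> * (\<epsilon>\<^sup>2 * \<bar>6 * x\<^sup>2 + 4 * \<epsilon> * x ^ 3 + \<epsilon>\<^sup>2 * x ^ 4\<bar>)"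
        by (simp add: abs_mult)
      also have "\<dots> \<le> 1 * (\<epsilon>\<^sup>2 * (11 * K ^ 4))"
      proof (intro mult_mono s)
        have "x\<^sup>2 \<le> K ^ 4"
        proof -
          have "x\<^sup>2 \<le> K\<^sup>2" using x by (metis abs_ge_zero power2_abs power_mono)
          also have "\<dots> \<le> K ^ 4" using K(1) by (intro power_increasing) auto
          finally show ?thesis .
        qed
        moreover have "\<bar>\<epsilon> * x ^ 3\<bar> \<le> K ^ 4"
        proof -
          have "\<bar>\<epsilon> * x ^ 3\<bar> \<le> 1 * K ^ 3"
            unfolding abs_mult power_abs using x \<epsilon>1 K(1) by (intro mult_mono power_mono) auto
          also have "\<dots> \<le> K ^ 4" using K(1) power_increasing [of 3 4 K] by simp
          finally show ?thesis .
        qed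
        moreover have "\<bar>\<epsilon>\<^sup>2 * x ^ 4\<bar> \<le> K ^ 4"
        proof -
          have "\<bar>\<epsilon>\<^sup>2 * x ^ 4\<bar> \<le> 1 * K ^ 4"
            unfolding abs_mult power_abs using x \<epsilon>1 K(1)
            by (intro mult_mono power_mono) (auto simp: abs_square_le_1)
          then show ?thesis by simp
        qed
        ultimately show "\<bar>6 * x\<^sup>2 + 4 * \<epsilon> * x ^ 3 + \<epsilon>\<^sup>2 * x ^ 4\<bar> \<le> 11 * K ^ 4"
          using zero_le_power2 [of x] by linarith
      qed auto
      finally show ?thesis by (simp add: mult_ac)
    qed
    have "norm (integral chart_box F) \<le> 11 * K ^ 4 * \<epsilon>\<^sup>2 * measure lborel chart_box"
      using int rem K(1) unfolding chart_box_def by (intro has_integral_bound) auto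
    then have num: "norm (integral chart_box F) \<le> M * \<epsilon>\<^sup>2"
      by (simp add: M_def mult_ac)
    have "continuous_on (sphere 0 1) g"
      using contG [of "sphere 0 1"] by (rule continuous_on_eq) (simp add: g)
    then have vol: "\<mu> \<le> measure lebesgue (radial_body g \<epsilon>)"
      unfolding \<mu>_def using half by (intro measure_radial_body_ge) auto
    have "norm (centroid (radial_body g \<epsilon>)) = norm (integral chart_box F) / measure lebesgue (radial_body g \<epsilon>)"
      by (simp add: centroid_def moment divide_inverse_commute)
    also have "\<dots> \<le> (M * \<epsilon>\<^sup>2) / \<mu>"
      by (intro frac_le num \<mu> vol order_trans [OF norm_ge_zero num])
    finally show ?thesis by simp
  qed
  show ?thesis
    by (rule that [of "1 / (2 * K)" "M / \<mu>", OF _ bound]) (use K(1) in auto)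
qed

section \<open>The spherical harmonics of degree at least two are orthogonal to linear functions\<close>

text \<open>A polynomial on the whole space that agrees with the spherical harmonic of order \<open>m \<ge> 1\<close> on the unit
  sphere: there \<open>(x + \<i> * y) ^ m\<close> absorbs both the factor \<open>sqrt (1 - z\<^sup>2) ^ m\<close> and the longitude. It
  makes smoothness evident also at the poles.\<close>

definition sph_harmonic_extension :: "nat \<Rightarrow> nat \<Rightarrow> real ^ 3 \<Rightarrow> real" where
  "sph_harmonic_extension l m y = Re (Complex (y $ 1) (y $ 2) ^ m) * poly ((pderiv ^^ m) (legendre_poly l)) (y $ 3)"

lemma sph_harmonic_extension_spherical_point:
  "sph_harmonic_extension l m (spherical_point \<theta> \<phi>)
     = sin \<theta> ^ m * cos (real m * \<phi>) * poly ((pderiv ^^ m) (legendre_poly l)) (cos \<theta>)"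
proof -
  have "Complex (spherical_point \<theta> \<phi> $ 1) (spherical_point \<theta> \<phi> $ 2) = rcis (sin \<theta>) \<phi>"
    by (simp add: spherical_point_def complex_eq_iff)
  then show ?thesis
    by (simp add: sph_harmonic_extension_def DeMoivre2) (simp add: spherical_point_def)
qed

lemma sph_harmonic_eq_extension:
  assumes "norm u = 1" "1 \<le> m"
  shows "sph_harmonic l m u = sph_harmonic_extension l m u"
proof -
  obtain \<theta> \<phi> where a: "0 \<le> \<theta>" "\<theta> \<le> pi" "u = spherical_point \<theta> \<phi>"
    using spherical_point_surj [OF assms(1)] by metis
  have "sqrt (1 - (cos \<theta>)\<^sup>2) = sin \<theta>"
    using a sin_ge_zero by (simp add: sin_squared_eq [symmetric])
  with a assms(2) show ?thesis
    by (simp add: sph_harmonic_spherical_point sph_harmonic_extension_spherical_point assoc_legendre_def)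
qed

lemma sph_harmonic_extension_differentiable: "sph_harmonic_extension l m differentiable (at y)"
proof -
  have "bounded_linear (\<lambda>y :: real ^ 3. of_real (y $ 1) + \<i> * of_real (y $ 2))"
    by (intro bounded_linear_add bounded_linear_const_mult bounded_linear_of_real
          bounded_linear_compose [OF bounded_linear_of_real] bounded_linear_vec_nth)
  then have lin: "(\<lambda>y :: real ^ 3. of_real (y $ 1) + \<i> * of_real (y $ 2)) differentiable (at y)"
    by (rule bounded_linear_imp_differentiable)
  have "(\<lambda>y :: real ^ 3. Re ((of_real (y $ 1) + \<i> * of_real (y $ 2)) ^ m)) differentiable (at y)"
    by (rule differentiable_compose [of Re])
       (auto intro: differentiable_power lin bounded_linear_imp_differentiable bounded_linear_Re)
  moreover have "(\<lambda>y :: real ^ 3. poly p (y $ 3)) differentiable (at y)" for p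
  proof (rule differentiable_compose [of "poly p"])
    show "poly p differentiable (at (y $ 3))"
      using poly_DERIV real_differentiable_def by blast
    show "(\<lambda>y :: real ^ 3. y $ 3) differentiable (at y)"
      by (intro bounded_linear_imp_differentiable bounded_linear_vec_nth)
  qed
  ultimately show ?thesis
    unfolding sph_harmonic_extension_def [abs_def] Complex_eq by (rule differentiable_mult)
qed

text \<open>After the substitution \<open>x = cos \<theta>\<close> this is the integral of \<open>(1 - x\<^sup>2) * P' x\<close>, where \<open>P\<close> is the
  Legendre polynomial, so the flux is an antiderivative.\<close>

lemma integral_legendre_dipole:
  assumes "2 \<le> l"
  shows "integral {0..pi} (\<lambda>\<theta>. sin \<theta> ^ 3 * poly (pderiv (legendre_poly l)) (cos \<theta>)) = 0"
proof -
  have "((\<lambda>\<theta>. sin \<theta> ^ 3 * poly (pderiv (legendre_poly l)) (cos \<theta>)) has_integral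
      (- poly (legendre_flux l) (cos pi) - (- poly (legendre_flux l) (cos 0)))) {0..pi}"
  proof (rule fundamental_theorem_of_calculus)
    fix \<theta> :: real
    have "((\<lambda>\<theta>. - poly (legendre_flux l) (cos \<theta>)) has_real_derivative
        - (poly (pderiv (legendre_flux l)) (cos \<theta>) * - sin \<theta>)) (at \<theta> within {0..pi})"
      by (intro DERIV_minus DERIV_chain' [OF has_field_derivative_at_within [OF DERIV_cos] poly_DERIV])
    also have "- (poly (pderiv (legendre_flux l)) (cos \<theta>) * - sin \<theta>)
        = sin \<theta> * (1 - (cos \<theta>)\<^sup>2) * poly (pderiv (legendre_poly l)) (cos \<theta>)"
      by (simp add: pderiv_legendre_flux [OF assms] power2_eq_square algebra_simps)
    also have "\<dots> = sin \<theta> ^ 3 * poly (pderiv (legendre_poly l)) (cos \<theta>)"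
      unfolding sin_squared_eq [symmetric] by (simp add: power2_eq_square power3_eq_cube)
    finally show "((\<lambda>\<theta>. - poly (legendre_flux l) (cos \<theta>)) has_vector_derivative
        sin \<theta> ^ 3 * poly (pderiv (legendre_poly l)) (cos \<theta>)) (at \<theta> within {0..pi})"
      by (simp add: has_real_derivative_iff_has_vector_derivative)
  qed simp
  then show ?thesis
    using assms by (simp add: poly_legendre_flux_boundary integral_unique)
qed

lemma integral_cos_cos_multiple:
  assumes "2 \<le> m"
  shows "integral {-pi..pi} (\<lambda>\<phi>. cos \<phi> * cos (real m * \<phi>)) = 0"
proof -
  have "((\<lambda>\<phi>. (cos (real (m - 1) * \<phi>) + cos (real (m + 1) * \<phi>)) / 2) has_integral (0 + 0) / 2) {-pi..pi}"
    by (intro has_integral_divide has_integral_add integral_cos_multiple) (use assms in auto)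
  moreover have "(cos (real (m - 1) * \<phi>) + cos (real (m + 1) * \<phi>)) / 2 = cos \<phi> * cos (real m * \<phi>)" for \<phi>
    using assms by (simp add: of_nat_diff algebra_simps cos_add cos_diff)
  ultimately show ?thesis by (simp add: integral_unique)
qed

lemma integral_sin_cos_multiple:
  assumes "1 \<le> m"
  shows "integral {-pi..pi} (\<lambda>\<phi>. sin \<phi> * cos (real m * \<phi>)) = 0"
proof -
  have "((\<lambda>\<phi>. (sin (real (m + 1) * \<phi>) - sin (real (m - 1) * \<phi>)) / 2) has_integral (0 - 0) / 2) {-pi..pi}"
    by (intro has_integral_divide has_integral_diff integral_sin_multiple)
  moreover have "(sin (real (m + 1) * \<phi>) - sin (real (m - 1) * \<phi>)) / 2 = sin \<phi> * cos (real m * \<phi>)" for \<phi>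
    using assms by (simp add: of_nat_diff algebra_simps sin_add sin_diff)
  ultimately show ?thesis by (simp add: integral_unique)
qed

text \<open>Each component is a product integral. The integral over the longitude vanishes for all of them except
  the first component with \<open>m = 1\<close>; there the integral over the colatitude vanishes because \<open>l \<ge> 2\<close>.\<close>

lemma sph_harmonic_extension_orthogonal_linear:
  assumes "1 \<le> m" "2 \<le> l"
  shows "integral chart_box (\<lambda>v. ((v $ 1) ^ 3 * sin (v $ 2) * sph_harmonic_extension l m (spherical_point (v $ 2) (v $ 3)))
           *\<^sub>R spherical_point (v $ 2) (v $ 3)) = 0"
proof (rule integral_chart_box_vector_eq_0)
  have "continuous_on UNIV (sph_harmonic_extension l m)"
    by (intro differentiable_imp_continuous_on differentiable_at_imp_differentiable_on sph_harmonic_extension_differentiable)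
  then have "continuous_on chart_box (\<lambda>v. sph_harmonic_extension l m (spherical_point (v $ 2) (v $ 3)))"
    by (rule continuous_on_compose2) (auto intro: continuous_intros)
  then show "continuous_on chart_box (\<lambda>v. ((v $ 1) ^ 3 * sin (v $ 2) * sph_harmonic_extension l m (spherical_point (v $ 2) (v $ 3)))
           *\<^sub>R spherical_point (v $ 2) (v $ 3))"
    by (intro continuous_intros)
next
  define Q where "Q = (pderiv ^^ m) (legendre_poly l)"
  have cQ: "continuous_on S (\<lambda>\<theta>. poly Q (cos \<theta>))" for S
    by (intro continuous_intros)
  have "integral {0..pi} (\<lambda>\<theta>. sin \<theta> ^ (m + 2) * poly Q (cos \<theta>)) *
      integral {-pi..pi} (\<lambda>\<phi>. cos \<phi> * cos (real m * \<phi>)) = 0"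
  proof (cases "m = 1")
    case True
    then show ?thesis using integral_legendre_dipole [OF assms(2)] by (simp add: Q_def numeral_3_eq_3)
  next
    case False
    then show ?thesis using integral_cos_cos_multiple [of m] assms(1) by simp
  qed
  then have "integral chart_box (\<lambda>v. (v $ 1) ^ 3 * (sin (v $ 2) ^ (m + 2) * poly Q (cos (v $ 2))) * (cos (v $ 3) * cos (real m * v $ 3))) = 0"
    by (subst integral_chart_box_prod) (auto intro!: continuous_intros cQ)
  moreover have "integral chart_box (\<lambda>v. (v $ 1) ^ 3 * (sin (v $ 2) ^ (m + 2) * poly Q (cos (v $ 2))) * (sin (v $ 3) * cos (real m * v $ 3))) = 0"
    using integral_sin_cos_multiple [OF assms(1)]
    by (subst integral_chart_box_prod) (auto intro!: continuous_intros cQ)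
  moreover have "integral chart_box (\<lambda>v. (v $ 1) ^ 3 * (sin (v $ 2) ^ (m + 1) * cos (v $ 2) * poly Q (cos (v $ 2))) * cos (real m * v $ 3)) = 0"
    using integral_cos_multiple [OF assms(1)]
    by (subst integral_chart_box_prod) (auto intro!: continuous_intros cQ simp: integral_unique)
  ultimately have "\<forall>i. integral chart_box (\<lambda>v. (((v $ 1) ^ 3 * sin (v $ 2) * sph_harmonic_extension l m (spherical_point (v $ 2) (v $ 3)))
           *\<^sub>R spherical_point (v $ 2) (v $ 3)) $ i) = 0"
    unfolding sph_harmonic_extension_spherical_point Q_def [symmetric]
    by (simp add: forall_3 spherical_point_def mult_ac)
  then show "integral chart_box (\<lambda>v. (((v $ 1) ^ 3 * sin (v $ 2) * sph_harmonic_extension l m (spherical_point (v $ 2) (v $ 3)))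
           *\<^sub>R spherical_point (v $ 2) (v $ 3)) $ i) = 0" for i
    by blast
qed

section \<open>Local extrema in regions and equilibria\<close>

text \<open>Extending the squared distance to be constant along rays turns a local extremum on the sphere into one
  in the ambient space, where the whole derivative vanishes by Fermat's theorem.\<close>

lemma sq_dist_fun_local_extremum_equilibrium:
  fixes G :: "real ^ 3 \<Rightarrow> real"
  assumes diff: "\<And>y. G differentiable (at y)"
    and g: "\<And>u. norm u = 1 \<Longrightarrow> g u = G u"
    and u: "u \<in> sphere 0 1" and D: "open D" "u \<in> D"
    and extr: "(\<forall>v\<in>D \<inter> sphere 0 1. sq_dist_fun g \<epsilon> v \<le> sq_dist_fun g \<epsilon> u) \<or>
               (\<forall>v\<in>D \<inter> sphere 0 1. sq_dist_fun g \<epsilon> u \<le> sq_dist_fun g \<epsilon> v)"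
  shows "u \<in> equilibria g \<epsilon>"
proof -
  define c where "c = centroid (radial_body g \<epsilon>)"
  define F where "F y = ((1 + \<epsilon> * G (sgn y)) *\<^sub>R sgn y - c) \<bullet> ((1 + \<epsilon> * G (sgn y)) *\<^sub>R sgn y - c)" for y
  have F: "F y = sq_dist_fun g \<epsilon> (sgn y)" if "y \<noteq> 0" for y
    using that by (simp add: F_def sq_dist_fun_def c_def power2_norm_eq_inner g norm_sgn)
  have u1: "norm u = 1" "sgn u = u" "u \<noteq> 0" using u by (auto simp: sgn_div_norm)
  have sgn: "sgn differentiable (at u)"
    unfolding sgn_div_norm [abs_def]
    by (intro differentiable_scaleR differentiable_inverse differentiable_norm_at) (use u1 in auto)
  have Gsgn: "(\<lambda>y. G (sgn y)) differentiable (at u)"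
    by (rule differentiable_compose [OF diff sgn])
  have "F differentiable (at u)"
    unfolding F_def [abs_def]
    by (intro differentiable_inner differentiable_diff differentiable_scaleR differentiable_add
        differentiable_mult differentiable_const Gsgn sgn)
  then obtain F' where F': "(F has_derivative F') (at u)"
    by (auto simp: differentiable_def)
  define N where "N = {y. y \<noteq> 0 \<and> sgn y \<in> D}"
  have "open N"
  proof -
    have "continuous_on (- {0}) (sgn :: real ^ 3 \<Rightarrow> _)"
      by (intro continuous_intros) auto
    then have "open (- {0} \<inter> sgn -` D)"
      by (rule continuous_open_preimage) (use D(1) in auto)
    moreover have "- {0} \<inter> sgn -` D = N" by (auto simp: N_def)
    ultimately show ?thesis by simp
  qed
  moreover have "u \<in> N" using u1 D by (simp add: N_def)
  moreover have "(\<forall>y\<in>N. F y \<le> F u) \<or> (\<forall>y\<in>N. F u \<le> F y)"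
    using extr u1 by (auto simp: N_def F norm_sgn)
  ultimately have "F' = (\<lambda>_. 0)"
    using differential_zero_maxmin F' by blast
  with F' have "(F has_derivative (\<lambda>_. 0)) (at u within sphere 0 1)"
    by (simp add: has_derivative_at_withinI)
  moreover have "F v = sq_dist_fun g \<epsilon> v" if "v \<in> sphere 0 1" for v
    using F [of v] that by (cases "v = 0") (auto simp: sgn_div_norm)
  ultimately have "(sq_dist_fun g \<epsilon> has_derivative (\<lambda>_. 0)) (at u within sphere 0 1)"
    by (rule has_derivative_transform_within [OF _ zero_less_one u])
  then show ?thesis using u by (simp add: equilibria_def)
qed

text \<open>A continuous function on the compact set \<open>k \<ge> 0\<close> attains its maximum, and the boundary \<open>k = 0\<close> is
  excluded by comparison with \<open>w\<close>.\<close>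

lemma local_max_in_region:
  fixes h k :: "real ^ 3 \<Rightarrow> real"
  assumes h: "continuous_on (sphere 0 1) h" and k: "continuous_on UNIV k"
    and w: "norm w = 1" "0 < k w"
    and low: "\<And>v. norm v = 1 \<Longrightarrow> k v = 0 \<Longrightarrow> h v < h w"
  obtains u where "norm u = 1" "0 < k u" "\<And>v. norm v = 1 \<Longrightarrow> 0 < k v \<Longrightarrow> h v \<le> h u"
proof -
  define S where "S = sphere 0 1 \<inter> {v. 0 \<le> k v}"
  have "closed {v. 0 \<le> k v}"
    using k by (intro closed_Collect_le continuous_on_const)
  then have "compact S" unfolding S_def by (intro compact_Int_closed) auto
  moreover have "w \<in> S" using w by (simp add: S_def)
  moreover have "continuous_on S h" using h by (rule continuous_on_subset) (auto simp: S_def)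
  ultimately obtain u where u: "u \<in> S" "\<And>v. v \<in> S \<Longrightarrow> h v \<le> h u"
    using continuous_attains_sup [of S h] by blast
  have "k u \<noteq> 0" using low [of u] u \<open>w \<in> S\<close> by (fastforce simp: S_def)
  with u show ?thesis by (intro that [of u]) (auto simp: S_def)
qed

lemma eventually_at_sphere_region:
  fixes k :: "real ^ 3 \<Rightarrow> real"
  assumes "continuous_on UNIV k" "0 < k u" "\<And>v. norm v = 1 \<Longrightarrow> 0 < k v \<Longrightarrow> P v"
  shows "\<forall>\<^sub>F v in at u within sphere 0 1. P v"
proof -
  have "open {v. 0 < k v}" using assms(1) by (intro open_Collect_less continuous_on_const)
  with assms(2,3) show ?thesis
    unfolding eventually_at_topological by (intro exI [of _ "{v. 0 < k v}"]) auto
qed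

lemma equilibrium_in_region:
  fixes G k :: "real ^ 3 \<Rightarrow> real"
  assumes diff: "\<And>y. G differentiable (at y)"
    and g: "\<And>u. norm u = 1 \<Longrightarrow> g u = G u"
    and k: "continuous_on UNIV k" and w: "norm w = 1" "0 < k w"
  shows "(\<And>v. norm v = 1 \<Longrightarrow> k v = 0 \<Longrightarrow> sq_dist_fun g \<epsilon> v < sq_dist_fun g \<epsilon> w)
           \<Longrightarrow> \<exists>u. 0 < k u \<and> u \<in> unstable_equilibria g \<epsilon>"
    and "(\<And>v. norm v = 1 \<Longrightarrow> k v = 0 \<Longrightarrow> sq_dist_fun g \<epsilon> w < sq_dist_fun g \<epsilon> v)
           \<Longrightarrow> \<exists>u. 0 < k u \<and> u \<in> stable_equilibria g \<epsilon>"
proof -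
  have "continuous_on (sphere 0 1) G"
    by (intro differentiable_imp_continuous_on differentiable_at_imp_differentiable_on diff)
  then have "continuous_on (sphere 0 1) g"
    by (rule continuous_on_eq) (simp add: g)
  then have cont: "continuous_on (sphere 0 1) (sq_dist_fun g \<epsilon>)"
    unfolding sq_dist_fun_def [abs_def] by (intro continuous_intros)
  have D: "open {v. 0 < k v}" using k by (intro open_Collect_less continuous_on_const)
  note eq = sq_dist_fun_local_extremum_equilibrium [where D = "{v. 0 < k v}" and \<epsilon> = \<epsilon>, OF diff g _ D]
  {
    assume "\<And>v. norm v = 1 \<Longrightarrow> k v = 0 \<Longrightarrow> sq_dist_fun g \<epsilon> v < sq_dist_fun g \<epsilon> w"
    then obtain u where u: "norm u = 1" "0 < k u"
      "\<And>v. norm v = 1 \<Longrightarrow> 0 < k v \<Longrightarrow> sq_dist_fun g \<epsilon> v \<le> sq_dist_fun g \<epsilon> u"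
      using local_max_in_region [OF cont k w] by blast
    then have "u \<in> equilibria g \<epsilon>" by (intro eq) auto
    moreover have "\<forall>\<^sub>F v in at u within sphere 0 1. sq_dist_fun g \<epsilon> v \<le> sq_dist_fun g \<epsilon> u"
      by (rule eventually_at_sphere_region [OF k u(2)]) (rule u(3))
    ultimately show "\<exists>u. 0 < k u \<and> u \<in> unstable_equilibria g \<epsilon>"
      unfolding unstable_equilibria_def using u(2) by blast
  next
    assume low: "\<And>v. norm v = 1 \<Longrightarrow> k v = 0 \<Longrightarrow> sq_dist_fun g \<epsilon> w < sq_dist_fun g \<epsilon> v"
    have "- sq_dist_fun g \<epsilon> v < - sq_dist_fun g \<epsilon> w" if "norm v = 1" "k v = 0" for v
      using low [OF that] by simp
    then obtain u where u: "norm u = 1" "0 < k u"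
      "\<And>v. norm v = 1 \<Longrightarrow> 0 < k v \<Longrightarrow> - sq_dist_fun g \<epsilon> v \<le> - sq_dist_fun g \<epsilon> u"
      using local_max_in_region [OF continuous_on_minus [OF cont] k w] by blast
    have u3: "sq_dist_fun g \<epsilon> u \<le> sq_dist_fun g \<epsilon> v" if "norm v = 1" "0 < k v" for v
      using u(3) [OF that] by simp
    then have "u \<in> equilibria g \<epsilon>" using u(1,2) by (intro eq) auto
    moreover have "\<forall>\<^sub>F v in at u within sphere 0 1. sq_dist_fun g \<epsilon> u \<le> sq_dist_fun g \<epsilon> v"
      by (rule eventually_at_sphere_region [OF k u(2)]) (rule u3)
    ultimately show "\<exists>u. 0 < k u \<and> u \<in> stable_equilibria g \<epsilon>"
      unfolding stable_equilibria_def using u(2) by blast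
  }
qed

text \<open>The regions \<open>k > 0\<close> and \<open>k < 0\<close> each contribute an equilibrium of the same type.\<close>

lemma not_mono_monostatic_two_regions:
  fixes G k :: "real ^ 3 \<Rightarrow> real"
  assumes diff: "\<And>y. G differentiable (at y)"
    and g: "\<And>u. norm u = 1 \<Longrightarrow> g u = G u"
    and k: "continuous_on UNIV k"
    and w: "norm w = 1" "0 < k w" and w': "norm w' = 1" "k w' < 0"
    and sep: "(\<forall>v. norm v = 1 \<longrightarrow> k v = 0 \<longrightarrow>
                 sq_dist_fun g \<epsilon> v < sq_dist_fun g \<epsilon> w \<and> sq_dist_fun g \<epsilon> v < sq_dist_fun g \<epsilon> w') \<or>
              (\<forall>v. norm v = 1 \<longrightarrow> k v = 0 \<longrightarrow>
                 sq_dist_fun g \<epsilon> w < sq_dist_fun g \<epsilon> v \<and> sq_dist_fun g \<epsilon> w' < sq_dist_fun g \<epsilon> v)"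
  shows "\<not> mono_monostatic g \<epsilon>"
proof -
  have k': "continuous_on UNIV (\<lambda>v. - k v)" using k by (rule continuous_on_minus)
  have w'': "0 < - k w'" using w' by simp
  note pos = equilibrium_in_region [OF diff g k w, where \<epsilon> = \<epsilon>]
    and neg = equilibrium_in_region [OF diff g k' w'(1) w'', where \<epsilon> = \<epsilon>]
  have two: "card A \<noteq> 1" if "\<exists>u. 0 < k u \<and> u \<in> A" "\<exists>u. 0 < - k u \<and> u \<in> A" for A
    using that by (auto simp: card_1_singleton_iff)
  from sep have "card (unstable_equilibria g \<epsilon>) \<noteq> 1 \<or> card (stable_equilibria g \<epsilon>) \<noteq> 1"
  proof
    assume *: "\<forall>v. norm v = 1 \<longrightarrow> k v = 0 \<longrightarrow>
      sq_dist_fun g \<epsilon> v < sq_dist_fun g \<epsilon> w \<and> sq_dist_fun g \<epsilon> v < sq_dist_fun g \<epsilon> w'"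
    have "card (unstable_equilibria g \<epsilon>) \<noteq> 1"
      by (rule two; rule pos(1) neg(1)) (use * in auto)
    then show ?thesis ..
  next
    assume *: "\<forall>v. norm v = 1 \<longrightarrow> k v = 0 \<longrightarrow>
      sq_dist_fun g \<epsilon> w < sq_dist_fun g \<epsilon> v \<and> sq_dist_fun g \<epsilon> w' < sq_dist_fun g \<epsilon> v"
    have "card (stable_equilibria g \<epsilon>) \<noteq> 1"
      by (rule two; rule pos(2) neg(2)) (use * in auto)
    then show ?thesis ..
  qed
  then show ?thesis by (auto simp: mono_monostatic_def)
qed

text \<open>The centroid enters the squared distance only through its norm and its inner product with \<open>u\<close>, both of
  order \<open>\<epsilon>\<^sup>2\<close> by assumption.\<close>

lemma sq_dist_fun_first_order:
  assumes bound: "\<And>u. norm u = 1 \<Longrightarrow> \<bar>g u\<bar> \<le> K"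
    and c: "0 < \<delta>" "\<And>\<epsilon>. \<bar>\<epsilon>\<bar> < \<delta> \<Longrightarrow> norm (centroid (radial_body g \<epsilon>)) \<le> C * \<epsilon>\<^sup>2"
  obtains M where "\<And>\<epsilon> u. \<bar>\<epsilon>\<bar> < min 1 \<delta> \<Longrightarrow> norm u = 1 \<Longrightarrow>
      \<bar>sq_dist_fun g \<epsilon> u - (1 + 2 * \<epsilon> * g u)\<bar> \<le> M * \<epsilon>\<^sup>2"
proof (rule that [of "K\<^sup>2 + 2 * (1 + K) * C + C\<^sup>2"])
  fix \<epsilon> :: real and u :: "real ^ 3" assume \<epsilon>: "\<bar>\<epsilon>\<bar> < min 1 \<delta>" and u: "norm u = 1"
  define c where "c = centroid (radial_body g \<epsilon>)"
  have cn: "norm c \<le> C * \<epsilon>\<^sup>2" using c(2) \<epsilon> by (simp add: c_def)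
  have K: "0 \<le> K" using bound [OF u] by linarith
  have "sq_dist_fun g \<epsilon> u = ((1 + \<epsilon> * g u) *\<^sub>R u - c) \<bullet> ((1 + \<epsilon> * g u) *\<^sub>R u - c)"
    by (simp add: sq_dist_fun_def c_def power2_norm_eq_inner)
  also have "\<dots> = (1 + \<epsilon> * g u)\<^sup>2 * (u \<bullet> u) - 2 * ((1 + \<epsilon> * g u) * (u \<bullet> c)) + c \<bullet> c"
    by (simp add: inner_diff_left inner_diff_right inner_commute power2_eq_square algebra_simps)
  also have "u \<bullet> u = 1" using u by (simp add: norm_eq_1)
  finally have eq: "sq_dist_fun g \<epsilon> u - (1 + 2 * \<epsilon> * g u)
      = \<epsilon>\<^sup>2 * (g u)\<^sup>2 - 2 * ((1 + \<epsilon> * g u) * (u \<bullet> c)) + c \<bullet> c"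
    by (simp add: power2_eq_square algebra_simps)
  have "\<bar>\<epsilon>\<^sup>2 * (g u)\<^sup>2\<bar> \<le> K\<^sup>2 * \<epsilon>\<^sup>2"
  proof -
    have "(g u)\<^sup>2 \<le> K\<^sup>2" using bound [OF u] abs_le_square_iff [of "g u" K] K by simp
    then have "\<epsilon>\<^sup>2 * (g u)\<^sup>2 \<le> \<epsilon>\<^sup>2 * K\<^sup>2" by (intro mult_left_mono) auto
    then show ?thesis by (simp add: mult.commute)
  qed
  moreover have "\<bar>(1 + \<epsilon> * g u) * (u \<bullet> c)\<bar> \<le> (1 + K) * (C * \<epsilon>\<^sup>2)"
    unfolding abs_mult
  proof (intro mult_mono)
    have "\<bar>\<epsilon> * g u\<bar> \<le> 1 * K"
      unfolding abs_mult using \<epsilon> bound [OF u] by (intro mult_mono) auto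
    then show "\<bar>1 + \<epsilon> * g u\<bar> \<le> 1 + K" by linarith
    show "\<bar>u \<bullet> c\<bar> \<le> C * \<epsilon>\<^sup>2"
      using Cauchy_Schwarz_ineq2 [of u c] cn u by simp
  qed (use K in auto)
  moreover have "\<bar>c \<bullet> c\<bar> \<le> C\<^sup>2 * \<epsilon>\<^sup>2"
  proof -
    have "\<bar>c \<bullet> c\<bar> = (norm c)\<^sup>2" by (simp add: power2_norm_eq_inner)
    also have "\<dots> \<le> (C * \<epsilon>\<^sup>2)\<^sup>2" using cn by (intro power_mono) auto
    also have "\<dots> = C\<^sup>2 * \<epsilon>\<^sup>2 * \<epsilon>\<^sup>2" by (simp add: power2_eq_square)
    also have "\<dots> \<le> C\<^sup>2 * \<epsilon>\<^sup>2 * 1"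
      using \<epsilon> by (intro mult_left_mono) (auto simp: abs_square_le_1)
    finally show ?thesis by simp
  qed
  ultimately have "\<bar>sq_dist_fun g \<epsilon> u - (1 + 2 * \<epsilon> * g u)\<bar> \<le> K\<^sup>2 * \<epsilon>\<^sup>2 + 2 * ((1 + K) * (C * \<epsilon>\<^sup>2)) + C\<^sup>2 * \<epsilon>\<^sup>2"
    unfolding eq by linarith
  then show "\<bar>sq_dist_fun g \<epsilon> u - (1 + 2 * \<epsilon> * g u)\<bar> \<le> (K\<^sup>2 + 2 * (1 + K) * C + C\<^sup>2) * \<epsilon>\<^sup>2"
    by (simp add: algebra_simps)
qed

text \<open>For small \<open>\<epsilon>\<close> the linear term \<open>2 * \<epsilon> * G\<close> at the two points \<open>w\<close> and \<open>w'\<close> dominates the quadratic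
  error, whereas on the nodal set \<open>k = 0\<close> there is nothing but the error. Whether the two resulting
  extrema are maxima or minima depends on the sign of \<open>\<epsilon>\<close>, but it is the same for both.\<close>

lemma not_mono_monostatic_nodal_separation:
  fixes G k :: "real ^ 3 \<Rightarrow> real"
  assumes diff: "\<And>y. G differentiable (at y)"
    and g: "\<And>u. norm u = 1 \<Longrightarrow> g u = G u"
    and orth: "integral chart_box (\<lambda>v. ((v $ 1) ^ 3 * sin (v $ 2) * G (spherical_point (v $ 2) (v $ 3)))
                 *\<^sub>R spherical_point (v $ 2) (v $ 3)) = 0"
    and k: "continuous_on UNIV k" and zero: "\<And>v. norm v = 1 \<Longrightarrow> k v = 0 \<Longrightarrow> G v = 0"
    and w: "norm w = 1" "0 < k w" and w': "norm w' = 1" "k w' < 0"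
    and same: "0 < G w * G w'"
  shows "\<exists>\<epsilon>\<^sub>0>0. \<forall>\<epsilon>. 0 < \<bar>\<epsilon>\<bar> \<and> \<bar>\<epsilon>\<bar> < \<epsilon>\<^sub>0 \<longrightarrow> \<not> mono_monostatic g \<epsilon>"
proof -
  obtain C \<delta> where c: "0 < \<delta>" "\<And>\<epsilon>. \<bar>\<epsilon>\<bar> < \<delta> \<Longrightarrow> norm (centroid (radial_body g \<epsilon>)) \<le> C * \<epsilon>\<^sup>2"
    using centroid_radial_body_quadratic [OF diff g orth] by blast
  have "bounded (G ` sphere 0 1)"
    by (intro compact_imp_bounded compact_continuous_image compact_sphere
          differentiable_imp_continuous_on differentiable_at_imp_differentiable_on diff)
  then obtain K where "\<forall>u\<in>sphere 0 1. \<bar>G u\<bar> \<le> K"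
    by (auto simp: bounded_iff)
  then have K: "\<And>u. norm u = 1 \<Longrightarrow> \<bar>g u\<bar> \<le> K" by (simp add: g)
  obtain M where M: "\<And>\<epsilon> u. \<bar>\<epsilon>\<bar> < min 1 \<delta> \<Longrightarrow> norm u = 1 \<Longrightarrow>
      \<bar>sq_dist_fun g \<epsilon> u - (1 + 2 * \<epsilon> * g u)\<bar> \<le> M * \<epsilon>\<^sup>2"
    using sq_dist_fun_first_order [OF K c] by blast
  define a where "a = min \<bar>G w\<bar> \<bar>G w'\<bar>"
  have a: "0 < a" using same by (auto simp: a_def)
  \<comment> \<open>The denominator \<open>\<bar>M\<bar> + 1\<close> is positive and exceeds \<open>M\<close>, so the error \<open>M * \<epsilon>\<^sup>2\<close> stays below \<open>\<bar>\<epsilon>\<bar> * a\<close>.\<close>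
  define \<epsilon>\<^sub>0 where "\<epsilon>\<^sub>0 = min (min 1 \<delta>) (a / (\<bar>M\<bar> + 1))"
  show ?thesis
  proof (intro exI [of _ \<epsilon>\<^sub>0] conjI allI impI)
    show "0 < \<epsilon>\<^sub>0" using c(1) a by (simp add: \<epsilon>\<^sub>0_def)
    fix \<epsilon> :: real assume \<epsilon>: "0 < \<bar>\<epsilon>\<bar> \<and> \<bar>\<epsilon>\<bar> < \<epsilon>\<^sub>0"
    define \<rho> where "\<rho> = sq_dist_fun g \<epsilon>"
    have "\<bar>\<epsilon>\<bar> * (\<bar>M\<bar> + 1) < a" using \<epsilon> by (simp add: \<epsilon>\<^sub>0_def pos_less_divide_eq)
    then have "\<bar>\<epsilon>\<bar> * \<bar>M\<bar> < a" using \<epsilon> by (simp add: algebra_simps)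
    then have "\<bar>\<epsilon>\<bar> * (\<bar>\<epsilon>\<bar> * \<bar>M\<bar>) < \<bar>\<epsilon>\<bar> * a" using \<epsilon> by (intro mult_strict_left_mono) auto
    moreover have "M * \<epsilon>\<^sup>2 \<le> \<bar>\<epsilon>\<bar> * (\<bar>\<epsilon>\<bar> * \<bar>M\<bar>)"
      by (simp add: power2_eq_square abs_mult [symmetric] mult_ac)
    ultimately have small: "M * \<epsilon>\<^sup>2 < \<bar>\<epsilon>\<bar> * a" by linarith
    have \<rho>: "\<bar>\<rho> u - (1 + 2 * (\<epsilon> * G u))\<bar> < \<bar>\<epsilon>\<bar> * a" if "norm u = 1" for u
      using M [of \<epsilon> u] \<epsilon> that small by (simp add: \<rho>_def \<epsilon>\<^sub>0_def g mult.assoc)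
    have \<rho>0: "\<bar>\<rho> v - 1\<bar> < \<bar>\<epsilon>\<bar> * a" if "norm v = 1" "k v = 0" for v
      using \<rho> [OF that(1)] zero [OF that] by simp
    have big: "\<bar>\<epsilon>\<bar> * a \<le> \<bar>\<epsilon> * G w\<bar>" "\<bar>\<epsilon>\<bar> * a \<le> \<bar>\<epsilon> * G w'\<bar>"
      unfolding abs_mult by (intro mult_left_mono; simp add: a_def)+
    have "0 < (\<epsilon> * G w) * (\<epsilon> * G w')"
    proof -
      have "0 < \<epsilon>\<^sup>2 * (G w * G w')"
        using \<epsilon> by (intro mult_pos_pos same) simp
      then show ?thesis by (simp add: power2_eq_square mult_ac)
    qed
    then have "(0 < \<epsilon> * G w \<and> 0 < \<epsilon> * G w') \<or> (\<epsilon> * G w < 0 \<and> \<epsilon> * G w' < 0)"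
      by (simp add: zero_less_mult_iff)
    then have "(\<forall>v. norm v = 1 \<longrightarrow> k v = 0 \<longrightarrow> \<rho> v < \<rho> w \<and> \<rho> v < \<rho> w') \<or>
               (\<forall>v. norm v = 1 \<longrightarrow> k v = 0 \<longrightarrow> \<rho> w < \<rho> v \<and> \<rho> w' < \<rho> v)"
    proof (elim disjE)
      assume p: "0 < \<epsilon> * G w \<and> 0 < \<epsilon> * G w'"
      have "\<rho> v < \<rho> w \<and> \<rho> v < \<rho> w'" if "norm v = 1" "k v = 0" for v
        using \<rho> [OF w(1)] \<rho> [OF w'(1)] \<rho>0 [OF that] big p by linarith
      then show ?thesis by blast
    next
      assume p: "\<epsilon> * G w < 0 \<and> \<epsilon> * G w' < 0"
      have "\<rho> w < \<rho> v \<and> \<rho> w' < \<rho> v" if "norm v = 1" "k v = 0" for v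
        using \<rho> [OF w(1)] \<rho> [OF w'(1)] \<rho>0 [OF that] big p by linarith
      then show ?thesis by blast
    qed
    then show "\<not> mono_monostatic g \<epsilon>"
      unfolding \<rho>_def
      by (rule not_mono_monostatic_two_regions [where G = G, OF diff _ k w w', rotated]) (rule g)
  qed
qed

section \<open>Nodal regions of the spherical harmonics\<close>

lemma spherical_point_arccos:
  fixes z :: real
  assumes "-1 < z" "z < 1"
  obtains \<theta> where "0 < sin \<theta>" "cos \<theta> = z"
proof (rule that)
  show "0 < sin (arccos z)"
    using assms arccos_lt_bounded [of z] by (intro sin_gt_zero) auto
  show "cos (arccos z) = z" using assms by simp
qed

text \<open>On the two half-planes that bound the sector, \<open>cos (m * \<phi>)\<close> vanishes. Rotating a point of the sector by
  \<open>2 * pi / m\<close>, which is \<open>4 * \<alpha>\<close> in the proof, does not change the harmonic but leaves the sector.\<close>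

lemma nodal_separation_sectors:
  assumes m: "2 \<le> m" and l: "m \<le> l"
  shows "\<exists>k w w'. continuous_on UNIV k \<and> (\<forall>v. norm v = 1 \<longrightarrow> k v = 0 \<longrightarrow> sph_harmonic_extension l m v = 0) \<and>
    norm w = 1 \<and> (0 :: real) < k w \<and> norm w' = 1 \<and> k w' < 0 \<and>
    0 < sph_harmonic_extension l m w * sph_harmonic_extension l m w'"
proof -
  define Q where "Q = (pderiv ^^ m) (legendre_poly l)"
  obtain z where z: "-1 < z" "z < 1" "poly Q z \<noteq> 0"
    using nonzero_poly_between [of Q "-1" 1] pderiv_funpow_legendre_neq_0 [OF l] by (auto simp: Q_def)
  obtain \<theta> where \<theta>: "0 < sin \<theta>" "cos \<theta> = z" using spherical_point_arccos [OF z(1,2)] .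
  define \<alpha> where "\<alpha> = pi / (2 * real m)"
  have m\<alpha>: "real m * \<alpha> = pi / 2" using m by (simp add: \<alpha>_def)
  have "\<alpha> \<le> pi / 4" using m by (simp add: \<alpha>_def field_simps)
  moreover have "0 < \<alpha>" using m by (simp add: \<alpha>_def)
  ultimately have \<alpha>: "0 < \<alpha>" "4 * \<alpha> \<le> pi" by auto
  have pos: "0 < sin \<alpha>" "0 < cos \<alpha>" "0 < sin (3 * \<alpha>)" "0 \<le> sin (4 * \<alpha>)"
    using \<alpha> by (auto intro!: sin_gt_zero cos_gt_zero sin_ge_zero)
  define k :: "real ^ 3 \<Rightarrow> real" where "k v = v $ 1 * sin \<alpha> - \<bar>v $ 2\<bar> * cos \<alpha>" for v
  have "continuous_on UNIV k"
    unfolding k_def [abs_def] by (intro continuous_intros)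
  moreover have "sph_harmonic_extension l m v = 0" if "k v = 0" for v
  proof -
    define r where "r = v $ 1 / cos \<alpha>"
    define \<beta> where "\<beta> = (if 0 \<le> v $ 2 then \<alpha> else - \<alpha>)"
    have "v $ 1 = r * cos \<alpha>" using pos by (simp add: r_def)
    moreover have "\<bar>v $ 2\<bar> = r * sin \<alpha>" using that pos by (simp add: k_def r_def field_simps)
    ultimately have "Complex (v $ 1) (v $ 2) = rcis r \<beta>"
      by (cases "0 \<le> v $ 2") (auto simp: complex_eq_iff \<beta>_def)
    moreover have "cos (real m * \<alpha>) = 0" by (simp only: m\<alpha> cos_pi_half)
    then have "cos (real m * \<beta>) = 0" by (simp add: \<beta>_def)
    ultimately show ?thesis by (simp add: sph_harmonic_extension_def DeMoivre2)
  qed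
  moreover have "0 < k (spherical_point \<theta> 0)"
    using \<theta> pos by (simp add: k_def spherical_point_def)
  moreover have "k (spherical_point \<theta> (4 * \<alpha>)) < 0"
  proof -
    have "k (spherical_point \<theta> (4 * \<alpha>)) = - (sin \<theta> * (sin (4 * \<alpha>) * cos \<alpha> - cos (4 * \<alpha>) * sin \<alpha>))"
      using \<theta> pos by (simp add: k_def spherical_point_def abs_mult algebra_simps)
    also have "sin (4 * \<alpha>) * cos \<alpha> - cos (4 * \<alpha>) * sin \<alpha> = sin (3 * \<alpha>)"
      using sin_diff [of "4 * \<alpha>" \<alpha>] by simp
    finally show ?thesis using \<theta> pos by simp
  qed
  moreover have "0 < sph_harmonic_extension l m (spherical_point \<theta> 0) * sph_harmonic_extension l m (spherical_point \<theta> (4 * \<alpha>))"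
  proof -
    have "real m * (4 * \<alpha>) = 2 * pi" using m\<alpha> by linarith
    then have "cos (real m * (4 * \<alpha>)) = 1" by (simp only: cos_two_pi)
    then have "sph_harmonic_extension l m (spherical_point \<theta> 0) * sph_harmonic_extension l m (spherical_point \<theta> (4 * \<alpha>))
        = (sin \<theta> ^ m * poly Q z)\<^sup>2"
      by (simp add: sph_harmonic_extension_spherical_point Q_def \<theta>(2) power2_eq_square)
    then show ?thesis using \<theta>(1) z(3) by simp
  qed
  ultimately show ?thesis
    by (intro exI [of _ k] exI [of _ "spherical_point \<theta> 0"] exI [of _ "spherical_point \<theta> (4 * \<alpha>)"]) simp
qed

text \<open>The harmonic is \<open>u $ 1\<close> times a polynomial in \<open>u $ 3\<close>, so it vanishes on the boundary of the region
  cut out by the plane \<open>u $ 1 = 0\<close> and a circle of latitude at a root. Below that circle both signs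
  occur, because the harmonic is odd in \<open>u $ 1\<close>.\<close>

lemma nodal_separation_order_one:
  assumes l: "2 \<le> l"
  shows "\<exists>k w w'. continuous_on UNIV k \<and> (\<forall>v. norm v = 1 \<longrightarrow> k v = 0 \<longrightarrow> sph_harmonic_extension l 1 v = 0) \<and>
    norm w = 1 \<and> (0 :: real) < k w \<and> norm w' = 1 \<and> k w' < 0 \<and>
    0 < sph_harmonic_extension l 1 w * sph_harmonic_extension l 1 w'"
proof -
  define Q where "Q = pderiv (legendre_poly l)"
  have Q: "Q \<noteq> 0" using pderiv_funpow_legendre_neq_0 [of 1 l] l by (simp add: Q_def)
  obtain z where z: "-1 < z" "z < 1" "poly Q z = 0"
    using pderiv_legendre_root [OF l] unfolding Q_def .
  obtain a where a: "z < a" "a < 1" "poly Q a \<noteq> 0"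
    using nonzero_poly_between [OF Q z(2)] .
  obtain b where b: "-1 < b" "b < z" "poly Q b \<noteq> 0"
    using nonzero_poly_between [OF Q z(1)] .
  obtain \<theta> where \<theta>: "0 < sin \<theta>" "cos \<theta> = a" using spherical_point_arccos [of a] a z by auto
  obtain \<theta>' where \<theta>': "0 < sin \<theta>'" "cos \<theta>' = b" using spherical_point_arccos [of b] b z by auto
  \<comment> \<open>The longitude of the second point is chosen so that the signs agree.\<close>
  define \<phi> where "\<phi> = (if 0 < poly Q a * poly Q b then 0 else pi)"
  define k :: "real ^ 3 \<Rightarrow> real" where "k v = min (v $ 1) (v $ 3 - z)" for v
  have "continuous_on UNIV k"
    unfolding k_def [abs_def] by (intro continuous_intros)
  moreover have "sph_harmonic_extension l 1 v = 0" if "k v = 0" for v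
    using that z(3) by (auto simp: sph_harmonic_extension_def k_def Q_def min_def split: if_splits)
  moreover have "0 < k (spherical_point \<theta> 0)" "k (spherical_point \<theta>' \<phi>) < 0"
    using \<theta> \<theta>' a b by (auto simp: k_def spherical_point_def)
  moreover have "0 < sph_harmonic_extension l 1 (spherical_point \<theta> 0) * sph_harmonic_extension l 1 (spherical_point \<theta>' \<phi>)"
  proof -
    have "poly Q a * poly Q b \<noteq> 0" using a(3) b(3) by simp
    then consider "0 < poly Q a * poly Q b" | "poly Q a * poly Q b < 0" by linarith
    then have "0 < cos \<phi> * (poly Q a * poly Q b)"
      by cases (simp_all add: \<phi>_def)
    then have "0 < (sin \<theta> * sin \<theta>') * (cos \<phi> * (poly Q a * poly Q b))"
      using \<theta> \<theta>' by simp
    then show ?thesis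
      by (simp add: sph_harmonic_extension_spherical_point Q_def \<theta>(2) \<theta>'(2) mult_ac)
  qed
  ultimately show ?thesis
    by (intro exI [of _ k] exI [of _ "spherical_point \<theta> 0"] exI [of _ "spherical_point \<theta>' \<phi>"]) simp
qed

lemma sph_harmonic_not_mono_monostatic:
  assumes "1 \<le> m" "m \<le> l" "2 \<le> l"
  shows "\<exists>\<epsilon>\<^sub>0>0. \<forall>\<epsilon>. 0 < \<bar>\<epsilon>\<bar> \<and> \<bar>\<epsilon>\<bar> < \<epsilon>\<^sub>0 \<longrightarrow> \<not> mono_monostatic (sph_harmonic l m) \<epsilon>"
proof -
  obtain k w w' where "continuous_on UNIV k" "\<forall>v. norm v = 1 \<longrightarrow> k v = 0 \<longrightarrow> sph_harmonic_extension l m v = 0"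
    "norm w = 1" "(0 :: real) < k w" "norm w' = 1" "k w' < 0"
    "0 < sph_harmonic_extension l m w * sph_harmonic_extension l m w'"
  proof (cases "m = 1")
    case True
    then show ?thesis using nodal_separation_order_one [OF assms(3)] that by blast
  next
    case False
    then show ?thesis using nodal_separation_sectors [of m l] assms that by force
  qed
  then show ?thesis
    by (intro not_mono_monostatic_nodal_separation [of "sph_harmonic_extension l m"] sph_harmonic_extension_differentiable
          sph_harmonic_extension_orthogonal_linear assms sph_harmonic_eq_extension) auto
qed

section \<open>Degree one\<close>

text \<open>The ray through \<open>u\<close> meets the unit sphere shifted by \<open>\<epsilon>\<close> along the first axis at distance
  \<open>\<epsilon> * x + sqrt (1 - \<epsilon>\<^sup>2 * (1 - x\<^sup>2))\<close>, where \<open>x = u $ 1\<close>, and the square root differs from 1 by at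
  most \<open>\<epsilon>\<^sup>2\<close>.\<close>

lemma first_order_translation_degree_one: "first_order_translation (sph_harmonic 1 1)"
proof -
  have g: "sph_harmonic 1 1 u = u $ 1" if "norm u = 1" for u
    using that by (simp add: sph_harmonic_eq_extension sph_harmonic_extension_def legendre_poly_def pderiv_pCons)
  have "\<exists>t>0. t *\<^sub>R u \<in> (+) (\<epsilon> *\<^sub>R axis 1 1) ` sphere 0 1 \<and> \<bar>t - (1 + \<epsilon> * sph_harmonic 1 1 u)\<bar> \<le> 1 * \<epsilon>\<^sup>2"
    if \<epsilon>: "\<bar>\<epsilon>\<bar> < 1/2" and u: "u \<in> sphere 0 1" for \<epsilon> u
  proof -
    have u1: "norm u = 1" using u by simp
    define x where "x = u $ 1"
    have x: "\<bar>x\<bar> \<le> 1" using component_le_norm_cart [of u 1] u1 by (simp add: x_def)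
    have x2: "0 \<le> 1 - x\<^sup>2" "1 - x\<^sup>2 \<le> 1" using x by (simp_all add: abs_square_le_1)
    define d where "d = \<epsilon>\<^sup>2 * (1 - x\<^sup>2)"
    have e2: "\<epsilon>\<^sup>2 \<le> 1/4"
      using \<epsilon> power_mono [of "\<bar>\<epsilon>\<bar>" "1/2" 2] by (simp add: power_divide)
    have d: "0 \<le> d" "d \<le> \<epsilon>\<^sup>2" using x2 by (simp_all add: d_def mult_left_le)
    have s: "1 - d \<le> sqrt (1 - d)" "sqrt (1 - d) \<le> 1"
      using d e2 by (auto intro!: real_le_rsqrt simp: power2_eq_square mult_left_le)
    define t where "t = \<epsilon> * x + sqrt (1 - d)"
    have ex: "\<bar>\<epsilon> * x\<bar> \<le> \<bar>\<epsilon>\<bar>" using x by (simp add: abs_mult mult_left_le)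
    have "0 < t" unfolding t_def using ex \<epsilon> s d e2 by linarith
    moreover have "t *\<^sub>R u \<in> (+) (\<epsilon> *\<^sub>R axis 1 1) ` sphere 0 1"
    proof -
      have "(norm (t *\<^sub>R u - \<epsilon> *\<^sub>R axis 1 1))\<^sup>2 = t\<^sup>2 - 2 * t * \<epsilon> * x + \<epsilon>\<^sup>2"
      proof -
        have "u \<bullet> u = 1" using u1 by (simp add: norm_eq_1)
        then show ?thesis
          unfolding power2_norm_eq_inner
          by (simp add: inner_diff_left inner_diff_right inner_axis inner_axis' x_def
                power2_eq_square algebra_simps)
      qed
      also have "\<dots> = (t - \<epsilon> * x)\<^sup>2 + d" by (simp add: d_def power2_eq_square algebra_simps)
      also have "\<dots> = 1" using d e2 by (simp add: t_def)
      finally have "norm (t *\<^sub>R u - \<epsilon> *\<^sub>R axis 1 1) = 1"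
        by (simp only: abs_square_eq_1 abs_norm_cancel)
      then show ?thesis by (intro image_eqI [of _ _ "t *\<^sub>R u - \<epsilon> *\<^sub>R axis 1 1"]) auto
    qed
    moreover have "\<bar>t - (1 + \<epsilon> * sph_harmonic 1 1 u)\<bar> \<le> 1 * \<epsilon>\<^sup>2"
      unfolding g [OF u1] t_def x_def [symmetric] using s d by linarith
    ultimately show ?thesis by blast
  qed
  then show ?thesis
    unfolding first_order_translation_def
    by (intro exI [of _ "axis 1 1"] exI [of _ 1] exI [of _ "1/2"]) auto
qed

section \<open>Mono-monostatic bodies\<close>

theorem corollary2:
  fixes l m :: nat
  assumes "1 \<le> m" and "m \<le> l"
  shows "(m * (l - m + 1) = 1 \<longrightarrow>
            m = 1 \<and> l = 1 \<and> first_order_translation (sph_harmonic l m)) \<and>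
         (2 \<le> l \<longrightarrow>
            (\<exists>\<epsilon>\<^sub>0>0. \<forall>\<epsilon>. 0 < \<bar>\<epsilon>\<bar> \<and> \<bar>\<epsilon>\<bar> < \<epsilon>\<^sub>0 \<longrightarrow>
               \<not> mono_monostatic (sph_harmonic l m) \<epsilon>))"
proof (intro conjI [where P = "m * (l - m + 1) = 1 \<longrightarrow> _"] impI)
  assume "m * (l - m + 1) = 1"
  then have "m = 1 \<and> l - m + 1 = 1" using nat_mult_eq_1_iff by blast
  then have "m = 1" "l = 1" using assms by auto
  then show "m = 1 \<and> l = 1 \<and> first_order_translation (sph_harmonic l m)"
    using first_order_translation_degree_one by simp
next
  assume "2 \<le> l"
  then show "\<exists>\<epsilon>\<^sub>0>0. \<forall>\<epsilon>. 0 < \<bar>\<epsilon>\<bar> \<and> \<bar>\<epsilon>\<bar> < \<epsilon>\<^sub>0 \<longrightarrow> \<not> mono_monostatic (sph_harmonic l m) \<epsilon>"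
    by (rule sph_harmonic_not_mono_monostatic [OF assms])
qed

end
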